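(* Let $K\subset\mathbb{R}^n$ be an $n$-dimensional convex polyhedron whose recession cone $\vec{\mathcal C}(K)$ is $n$-dimensional. Then $K$ is a polynomial image of $\mathbb{R}^n$ and $\operatorname{Int}(K)$ is a polynomial image of $\mathbb{R}^{n+1}$.
   Context: A convex polyhedron $K\subset\mathbb{R}^n$ is a (nonempty) finite intersection of closed affine half-spaces. Its dimension is the dimension of the smallest affine subspace containing it, and $\operatorname{Int}(K)$ is its relative interior in that affine subspace. The recession cone of $K$ is $\vec{\mathcal C}(K):=\{\vec v\in\mathbb{R}^n:\ p+\lambda\vec v\in K\ \text{for all}\ \lambda\ge 0\}$, where $p\in K$ is any point (the set does not depend on $p$); it is a convex polyhedral cone. A map $f:\mathbb{R}^m\to\mathbb{R}^n$ is polynomial if all its components are polynomials with real coefficients, and a set $S\subset\mathbb{R}^n$ is a polynomial image of $\mathbb{R}^m$ if there is a polynomial map $f:\mathbb{R}^m\to\mathbb{R}^n$ with $f(\mathbb{R}^m)=S$. *)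

theory Defs
  imports "HOL-Analysis.Analysis"
begin

text \<open>
  The base point \<open>p\<close> is quantified universally; for nonempty polyhedra any single
  base point gives the same set, see \<open>recession_cone_polyhedron_eq\<close> below.
\<close>

definition recession_cone :: "'a::real_vector set \<Rightarrow> 'a set" where
  "recession_cone K = {v. \<forall>p\<in>K. \<forall>l\<ge>0. p + l *\<^sub>R v \<in> K}"

lemma recession_cone_polyhedron_eq:
  fixes K :: "'a::euclidean_space set"
  assumes "polyhedron K" and "p \<in> K"
  shows "recession_cone K = {v. \<forall>l\<ge>0. p + l *\<^sub>R v \<in> K}"
proof (intro equalityI subsetI)
  fix v assume "v \<in> recession_cone K"
  then show "v \<in> {v. \<forall>l\<ge>0. p + l *\<^sub>R v \<in> K}"
    using assms(2) by (auto simp: recession_cone_def)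
next
  fix v assume "v \<in> {v. \<forall>l\<ge>0. p + l *\<^sub>R v \<in> K}"
  then have v: "p + l *\<^sub>R v \<in> K" if "l \<ge> 0" for l
    using that by auto
  obtain F where K: "K = \<Inter>F"
    and F: "\<And>h. h \<in> F \<Longrightarrow> \<exists>a b. a \<noteq> 0 \<and> h = {x. a \<bullet> x \<le> b}"
    using assms(1) unfolding polyhedron_def by blast
  have "q + l *\<^sub>R v \<in> h" if q: "q \<in> K" and l: "l \<ge> 0" and h: "h \<in> F" for q h and l :: real
  proof -
    obtain a b where hab: "h = {x. a \<bullet> x \<le> b}"
      using F[OF h] by blast
    have le: "a \<bullet> p + t * (a \<bullet> v) \<le> b" if "t \<ge> 0" for t
      using v[OF that] h by (auto simp: K hab inner_add_right)
    have "a \<bullet> v \<le> 0"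
    proof (rule ccontr)
      assume "\<not> a \<bullet> v \<le> 0"
      then have pos: "a \<bullet> v > 0" by simp
      have "a \<bullet> p \<le> b" using le[of 0] by simp
      then have "(b - a \<bullet> p + 1) / (a \<bullet> v) \<ge> 0" using pos by simp
      from le[OF this] pos show False by simp
    qed
    then have "l * (a \<bullet> v) \<le> 0"
      using l by (simp add: mult_nonneg_nonpos)
    moreover have "a \<bullet> q \<le> b" using q h by (auto simp: K hab)
    ultimately show ?thesis by (simp add: hab inner_add_right)
  qed
  then show "v \<in> recession_cone K"
    unfolding recession_cone_def K by blast
qed

end

theory Submission
  imports Defs
begin

text \<open>
  Let \<open>C\<close> be the recession cone of \<open>K\<close> and \<open>v\<close> a vector in
  its interior. If \<open>- v \<in> C\<close>, then \<open>K\<close> is the whole space, so let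
  \<open>- v \<notin> C\<close>.

  The difficulty lies in the facets. A nonconstant polynomial path is unbounded, so it cannot stay
  on a bounded facet, and the map has to cover each bounded facet as a fold. The solution is a
  family of moving pieces, simplices plus cones of dimension \<open>n - 1\<close>, whose vertices
  follow polynomial paths \<open>\<alpha>\<^sub>k\<close> in \<open>K\<close> and whose directions
  follow polynomial paths \<open>\<beta>\<^sub>k\<close> in \<open>C\<close>. With
  \<open>x\<^sub>k = z\<^sub>k\<^sup>2\<close> for \<open>k \<noteq> 0\<close>, \<open>w = 1 +
  \<Sum> x\<^sub>k\<close> and the time \<open>s = z\<^sub>0 w\<close>, consider \<open>F z =
  (\<alpha>\<^sub>0 s + \<Sum> x\<^sub>k \<alpha>\<^sub>k s) / w + \<Sum> x\<^sub>k
  \<beta>\<^sub>k s\<close>. Its values lie in \<open>K\<close> by convexity. It is also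
  polynomial if all \<open>\<alpha>\<^sub>k - \<alpha>\<^sub>0\<close> are divisible by
  \<open>s\<close>, because \<open>s / w = z\<^sub>0\<close>. For fixed \<open>s\<close> the
  numbers \<open>x\<^sub>k\<close> are projective coordinates in a simplex and affine coordinates
  in a cone, so all bounded and unbounded facets can be parametrized in this way.

  At finitely many times the moving piece is made to coincide with a prescribed piece
  \<open>T\<close>, and it leaves \<open>T\<close> to second order in a prescribed direction
  \<open>V \<in> C\<close>, up to a small relative error
  (\<open>polynomial_map_near_sweeps\<close>). At the node itself there is no error, so points of
  \<open>T\<close> are attained exactly. At height \<open>\<tau>\<close> above \<open>T\<close>
  the error is a small multiple of \<open>\<tau>\<close>, and by Brouwer's theorem every point
  whose coordinates in the ideal sweep are at least a fixed multiple of \<open>\<tau>\<close> is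
  still attained (\<open>perturbed_sweep_covers\<close>).

  What remains is convex geometry (\<open>finite_sweep_cover\<close>): finitely many sweeps must
  reach each point of \<open>K\<close> with such margins. The cone over \<open>K\<close> is
  finitely generated, and an exchange argument writes each point as a nonnegative combination of
  independent generators plus \<open>\<tau> v\<close>. For bounded \<open>\<tau>\<close>, tilting
  \<open>v\<close> outwards raises all small coefficients (\<open>near_datum\<close>). Points with
  large \<open>\<tau>\<close> lie in a translate of \<open>C\<close>, where a generator with the
  smallest coefficient can serve as the axis (\<open>deep_datum\<close>).

  The interior is \<open>K\<close> plus the positive multiples of \<open>v\<close>. One more
  variable suffices for it because the open half-plane is a polynomial image of the plane
  (\<open>half_plane_surjection\<close>).
\<close>

section \<open>Estimates for polynomials in one variable\<close>

text \<open>
  A local Lipschitz bound at a fixed point, by induction on the way the polynomial is built. It is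
  the only analytic input for the weights below.
\<close>

lemma real_polynomial_function_diff_bound:
  fixes f :: "real \<Rightarrow> real"
  assumes "real_polynomial_function f"
  shows "\<exists>D\<ge>0. \<forall>d. \<bar>d\<bar> \<le> 1 \<longrightarrow> \<bar>f (a + d) - f a\<bar> \<le> D * \<bar>d\<bar>"
  using assms
proof (induction rule: real_polynomial_function.induct)
  case (linear f)
  interpret bounded_linear f by fact
  have "\<bar>f (a + d) - f a\<bar> \<le> \<bar>f 1\<bar> * \<bar>d\<bar>" for d
  proof -
    have "f (a + d) - f a = f d" by (simp add: add)
    also have "\<dots> = d * f 1" using scaleR[of d 1] by simp
    finally show ?thesis by (simp add: abs_mult)
  qed
  then show ?case by (intro exI[of _ "\<bar>f 1\<bar>"]) simp
next
  case (const c)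
  then show ?case by (intro exI[of _ 0]) simp
next
  case (add f g)
  then obtain D E where D: "D \<ge> 0" "E \<ge> 0"
    "\<And>d. \<bar>d\<bar> \<le> 1 \<Longrightarrow> \<bar>f (a + d) - f a\<bar> \<le> D * \<bar>d\<bar>"
    "\<And>d. \<bar>d\<bar> \<le> 1 \<Longrightarrow> \<bar>g (a + d) - g a\<bar> \<le> E * \<bar>d\<bar>" by blast
  have "\<bar>(f (a + d) + g (a + d)) - (f a + g a)\<bar> \<le> (D + E) * \<bar>d\<bar>" if "\<bar>d\<bar> \<le> 1" for d
    using D(3)[OF that] D(4)[OF that] by (simp add: distrib_right)
  then show ?case using D by (intro exI[of _ "D + E"]) simp
next
  case (mult f g)
  then obtain D E where D: "D \<ge> 0" "E \<ge> 0"
    "\<And>d. \<bar>d\<bar> \<le> 1 \<Longrightarrow> \<bar>f (a + d) - f a\<bar> \<le> D * \<bar>d\<bar>"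
    "\<And>d. \<bar>d\<bar> \<le> 1 \<Longrightarrow> \<bar>g (a + d) - g a\<bar> \<le> E * \<bar>d\<bar>" by blast
  define B where "B = (\<bar>f a\<bar> + D) * E + \<bar>g a\<bar> * D"
  have "\<bar>f (a + d) * g (a + d) - f a * g a\<bar> \<le> B * \<bar>d\<bar>" if d: "\<bar>d\<bar> \<le> 1" for d
  proof -
    have "\<bar>f (a + d)\<bar> \<le> \<bar>f a\<bar> + D"
      using D(3)[OF d] mult_left_le[OF d D(1)] by linarith
    moreover have "f (a + d) * g (a + d) - f a * g a
        = f (a + d) * (g (a + d) - g a) + g a * (f (a + d) - f a)"
      by (simp add: algebra_simps)
    moreover have "\<bar>f (a + d) * (g (a + d) - g a)\<bar> \<le> (\<bar>f a\<bar> + D) * (E * \<bar>d\<bar>)"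
      unfolding abs_mult using D(4)[OF d] calculation(1) D(1) by (intro mult_mono) auto
    moreover have "\<bar>g a * (f (a + d) - f a)\<bar> \<le> \<bar>g a\<bar> * (D * \<bar>d\<bar>)"
      unfolding abs_mult using D(3)[OF d] by (intro mult_left_mono) auto
    ultimately have "\<bar>f (a + d) * g (a + d) - f a * g a\<bar>
        \<le> (\<bar>f a\<bar> + D) * (E * \<bar>d\<bar>) + \<bar>g a\<bar> * (D * \<bar>d\<bar>)"
      by linarith
    then show ?thesis by (simp add: B_def algebra_simps)
  qed
  moreover have "B \<ge> 0" using D by (simp add: B_def)
  ultimately show ?case by (intro exI[of _ B]) simp
qed

lemma one_minus_prod_le_sum:
  fixes u :: "'i \<Rightarrow> real"
  assumes "finite I" "\<And>i. i \<in> I \<Longrightarrow> 0 \<le> u i \<and> u i \<le> 1"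
  shows "1 - prod u I \<le> (\<Sum>i\<in>I. 1 - u i)"
  using assms
proof (induction I rule: finite_induct)
  case (insert i I)
  have p: "0 \<le> prod u I" "prod u I \<le> 1" using insert by (auto intro!: prod_nonneg prod_le_1)
  have "1 - u i * prod u I \<le> (1 - u i) + (1 - prod u I)"
  proof -
    have "0 \<le> (1 - u i) * (1 - prod u I)" using p insert.prems[of i] by (intro mult_nonneg_nonneg) auto
    then show ?thesis by (simp add: algebra_simps)
  qed
  then show ?case using insert by fastforce
qed simp

text \<open>
  The weights that make polynomial paths pass through prescribed positions. Let
  \<open>q\<^sub>j\<close> be the Lagrange polynomial that belongs to the node \<open>j +
  1\<close> among the nodes \<open>0, 1, \<dots>, N\<close>, and \<open>Q\<^sub>j =
  q\<^sub>j\<^sup>2\<close>. The position weight of this node is \<open>L\<^sub>j = 1 + (Q\<^sub>j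
  - 1)\<^sup>3 = Q\<^sub>j (3 - 3 Q\<^sub>j + Q\<^sub>j\<^sup>2)\<close>: the second form is
  nonnegative and vanishes to second order at the other nodes, and the first one shows that
  \<open>L\<^sub>j\<close> equals 1 at its own node without a linear term there. The velocity
  weight \<open>l\<^sub>j\<close> behaves like the square of the distance at its own node and is
  negligible at the others.

  Nonnegative polynomials with sum 1 are bounded and hence constant, but a total weight of at
  least 1 is enough for a set with a full-dimensional recession cone. The filler \<open>\<omega> =
  \<Prod>\<^sub>j (1 - Q\<^sub>j)\<^sup>2\<close> secures this bound and still vanishes to second
  order at each node.

  Node 0 is added so that each position weight is divisible by \<open>s\<^sup>2\<close>, with
  quotient \<open>W\<^sub>j\<close>; this divisibility is what later turns a rational
  parametrization into a polynomial one.
\<close>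

lemma interpolation_weights:
  fixes N :: nat
  obtains W l :: "nat \<Rightarrow> real \<Rightarrow> real" and \<omega> :: "real \<Rightarrow> real" and D :: real
  where "\<And>j. real_polynomial_function (W j)" "\<And>j. real_polynomial_function (l j)"
    "real_polynomial_function \<omega>"
    "\<And>j s. 0 \<le> W j s" "\<And>j s. 0 \<le> l j s" "\<And>s. 0 \<le> \<omega> s"
    "\<And>s. 1 \<le> (\<Sum>j<N. s\<^sup>2 * W j s) + \<omega> s"
    "0 \<le> D"
    "\<And>i j d. \<lbrakk>i < N; j < N; \<bar>d\<bar> \<le> 1\<rbrakk> \<Longrightarrow>
      \<bar>(real (Suc i) + d)\<^sup>2 * W j (real (Suc i) + d) - (if j = i then 1 else 0)\<bar> \<le> D * d\<^sup>2"
    "\<And>i d. \<lbrakk>i < N; \<bar>d\<bar> \<le> 1\<rbrakk> \<Longrightarrow> \<omega> (real (Suc i) + d) \<le> D * d\<^sup>2"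
    "\<And>i j d. \<lbrakk>i < N; j < N; \<bar>d\<bar> \<le> 1\<rbrakk> \<Longrightarrow>
      \<bar>l j (real (Suc i) + d) - (if j = i then d\<^sup>2 else 0)\<bar> \<le> D * \<bar>d\<bar> ^ 3"
proof -
  define q' where "q' j s = (\<Prod>i\<in>{..<N} - {j}. (s - real (Suc i)) / (real j - real i)) / real (Suc j)"
    for j and s :: real
  define q where "q j s = s * q' j s" for j s
  define Q where "Q j s = (q j s)\<^sup>2" for j s
  define L where "L j s = Q j s * (3 - 3 * Q j s + (Q j s)\<^sup>2)" for j s
  define W where "W j s = (q' j s)\<^sup>2 * (3 - 3 * Q j s + (Q j s)\<^sup>2)" for j s
  define \<omega> where "\<omega> s = (\<Prod>j<N. (1 - Q j s)\<^sup>2)" for s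
  define l where "l j s = (s - real (Suc j))\<^sup>2 * (Q j s)\<^sup>2" for j s
  have poly_s: "real_polynomial_function (\<lambda>s::real. s)"
    by (simp add: real_polynomial_function_eq)
  note pf = real_polynomial_function.intros(2-4)
    real_polynomial_function_diff real_polynomial_function_divide real_polynomial_function_prod
    real_polynomial_function_power poly_s
  have pq': "real_polynomial_function (q' j)" for j
    unfolding q'_def by (intro pf) auto
  then have pq: "real_polynomial_function (q j)" for j
    unfolding q_def by (intro pf)
  then have pQ: "real_polynomial_function (Q j)" for j
    unfolding Q_def by (intro pf)
  have pos3: "0 \<le> 3 - 3 * x + x\<^sup>2" for x :: real
    using zero_le_power2[of "x - 3/2"] by (simp add: power2_eq_square algebra_simps)
  have L_W: "s\<^sup>2 * W j s = L j s" for j s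
    by (simp add: L_def W_def Q_def q_def power_mult_distrib)
  have L_cube: "L j s = 1 + (Q j s - 1) ^ 3" for j s
    by (simp add: L_def power2_eq_square power3_eq_cube algebra_simps)
  have Q0: "0 \<le> Q j s" for j s by (simp add: Q_def)
  have L0: "0 \<le> L j s" for j s
    unfolding L_def by (intro mult_nonneg_nonneg Q0 pos3)
  (* If some \<open>Q j s\<close> is at least 1, its own weight suffices; otherwise \<open>L j = 1 - (1 - Q j)^3\<close> dominates
     \<open>1 - (1 - Q j)^2\<close>, and these terms add up to at least 1 minus the product \<open>\<omega>\<close>. *)
  have sum1: "1 \<le> (\<Sum>j<N. L j s) + \<omega> s" for s
  proof (cases "\<exists>j<N. 1 \<le> Q j s")
    case True
    then obtain j where j: "j < N" "1 \<le> Q j s" by blast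
    have "1 \<le> L j s" using j by (simp add: L_cube)
    also have "\<dots> \<le> (\<Sum>j<N. L j s)" using j by (intro member_le_sum) (auto simp: L0)
    finally show ?thesis by (simp add: \<omega>_def prod_nonneg add_increasing2)
  next
    case False
    define u where "u j = (1 - Q j s)" for j
    have u: "0 \<le> u j" "u j \<le> 1" if "j < N" for j
      using False that Q0[of j s] by (auto simp: u_def not_le less_imp_le)
    have "1 - (\<Prod>j<N. (u j)\<^sup>2) \<le> (\<Sum>j<N. 1 - (u j)\<^sup>2)"
      by (rule one_minus_prod_le_sum) (auto simp: u power_le_one)
    also have "\<dots> \<le> (\<Sum>j<N. L j s)"
    proof (rule sum_mono)
      fix j assume "j \<in> {..<N}"
      then have "u j ^ 3 \<le> (u j)\<^sup>2" using u[of j] by (intro power_decreasing) auto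
      moreover have "L j s = 1 - u j ^ 3"
        by (simp add: L_cube u_def power3_eq_cube algebra_simps)
      ultimately show "1 - (u j)\<^sup>2 \<le> L j s" by simp
    qed
    finally show ?thesis by (simp add: \<omega>_def u_def)
  qed
  have node: "q j (real (Suc i)) = (if j = i then 1 else 0)" if "i < N" "j < N" for i j
  proof (cases "j = i")
    case True
    have "(\<Prod>k\<in>{..<N} - {j}. (real (Suc i) - real (Suc k)) / (real j - real k)) = 1"
      by (rule prod.neutral) (auto simp: True)
    then show ?thesis using True by (simp add: q_def q'_def)
  next
    case False
    have "(\<Prod>k\<in>{..<N} - {j}. (real (Suc i) - real (Suc k)) / (real j - real k)) = 0"
      by (rule prod_zero) (use that False in \<open>auto intro!: bexI[of _ i]\<close>)
    then show ?thesis using False by (simp add: q_def q'_def)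
  qed
  have "\<exists>D\<ge>0. \<forall>d. \<bar>d\<bar> \<le> 1 \<longrightarrow> \<bar>q j (real (Suc i) + d) - q j (real (Suc i))\<bar> \<le> D * \<bar>d\<bar>" for i j
    by (rule real_polynomial_function_diff_bound[OF pq])
  then have "\<forall>i j. \<exists>D. 0 \<le> D \<and> (\<forall>d. \<bar>d\<bar> \<le> 1 \<longrightarrow> \<bar>q j (real (Suc i) + d) - q j (real (Suc i))\<bar> \<le> D * \<bar>d\<bar>)"
    by blast
  then obtain D' where D'_all: "\<forall>i j. 0 \<le> D' i j \<and>
      (\<forall>d. \<bar>d\<bar> \<le> 1 \<longrightarrow> \<bar>q j (real (Suc i) + d) - q j (real (Suc i))\<bar> \<le> D' i j * \<bar>d\<bar>)"
    unfolding choice_iff by blast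
  then have D': "\<And>i j. 0 \<le> D' i j"
    "\<And>i j d. \<bar>d\<bar> \<le> 1 \<Longrightarrow> \<bar>q j (real (Suc i) + d) - q j (real (Suc i))\<bar> \<le> D' i j * \<bar>d\<bar>"
    by blast+
  define B where "B = (\<Sum>i<N. \<Sum>j<N. D' i j)"
  have B0: "0 \<le> B" unfolding B_def by (intro sum_nonneg D')
  have B: "\<bar>q j (real (Suc i) + d) - (if j = i then 1 else 0)\<bar> \<le> B * \<bar>d\<bar>"
    if "i < N" "j < N" "\<bar>d\<bar> \<le> 1" for i j d
  proof -
    have "D' i j \<le> (\<Sum>j<N. D' i j)" using that by (intro member_le_sum) (auto simp: D')
    also have "\<dots> \<le> B" unfolding B_def
      using that by (intro member_le_sum) (auto intro!: sum_nonneg simp: D')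
    finally have "D' i j * \<bar>d\<bar> \<le> B * \<bar>d\<bar>" by (intro mult_right_mono) auto
    then show ?thesis using D'(2)[OF that(3), of j i] node[OF that(1,2)] by simp
  qed
  define K where "K = (2 + B) * B"
  have K0: "0 \<le> K" using B0 by (simp add: K_def)
  have Q1: "\<bar>Q i (real (Suc i) + d) - 1\<bar> \<le> K * \<bar>d\<bar>" if "i < N" "\<bar>d\<bar> \<le> 1" for i d
  proof -
    let ?e = "q i (real (Suc i) + d) - 1"
    have e: "\<bar>?e\<bar> \<le> B * \<bar>d\<bar>" using B[OF that(1) that(1) that(2)] by simp
    have "B * \<bar>d\<bar> \<le> B" using that B0 by (simp add: mult_left_le)
    then have "\<bar>2 + ?e\<bar> \<le> 2 + B" using e by linarith
    then have "\<bar>(2 + ?e) * ?e\<bar> \<le> (2 + B) * (B * \<bar>d\<bar>)"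
      unfolding abs_mult using e by (intro mult_mono) (use B0 in auto)
    moreover have "Q i (real (Suc i) + d) - 1 = (2 + ?e) * ?e"
      by (simp add: Q_def power2_eq_square algebra_simps)
    ultimately show ?thesis by (simp add: K_def mult.assoc)
  qed
  have sq1: "d\<^sup>2 \<le> 1" if "\<bar>d\<bar> \<le> 1" for d :: real
    using that by (simp add: abs_square_le_1)
  have Q2: "Q j (real (Suc i) + d) \<le> B\<^sup>2 * d\<^sup>2" "Q j (real (Suc i) + d) \<le> B\<^sup>2"
    if "i < N" "j < N" "j \<noteq> i" "\<bar>d\<bar> \<le> 1" for i j d
  proof -
    have "\<bar>q j (real (Suc i) + d)\<bar> \<le> B * \<bar>d\<bar>" using B[OF that(1,2,4)] that(3) by simp
    then have "(q j (real (Suc i) + d))\<^sup>2 \<le> (B * \<bar>d\<bar>)\<^sup>2"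
      by (metis abs_ge_zero power2_abs power_mono)
    then show 1: "Q j (real (Suc i) + d) \<le> B\<^sup>2 * d\<^sup>2" by (simp add: Q_def power_mult_distrib)
    have "B\<^sup>2 * d\<^sup>2 \<le> B\<^sup>2" using sq1[OF that(4)] by (simp add: mult_left_le)
    then show "Q j (real (Suc i) + d) \<le> B\<^sup>2" using 1 by simp
  qed
  define c1 where "c1 = K ^ 3"
  define c2 where "c2 = B\<^sup>2 * (3 + B ^ 4)"
  define c3 where "c3 = K\<^sup>2 * ((1 + B\<^sup>2)\<^sup>2) ^ N"
  define c4 where "c4 = K * (2 + K)"
  define c5 where "c5 = (real N + 1)\<^sup>2 * B ^ 4"
  define D where "D = c1 + c2 + c3 + c4 + c5"
  have c0: "0 \<le> c1" "0 \<le> c2" "0 \<le> c3" "0 \<le> c4" "0 \<le> c5"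
    using K0 B0 by (simp_all add: c1_def c2_def c3_def c4_def c5_def)
  have LB: "\<bar>L j (real (Suc i) + d) - (if j = i then 1 else 0)\<bar> \<le> D * d\<^sup>2"
    if "i < N" "j < N" "\<bar>d\<bar> \<le> 1" for i j d
  proof (cases "j = i")
    case True
    have "\<bar>L i (real (Suc i) + d) - 1\<bar> = \<bar>Q i (real (Suc i) + d) - 1\<bar> ^ 3"
      by (simp add: L_cube power_abs)
    also have "\<dots> \<le> (K * \<bar>d\<bar>) ^ 3" using Q1[of i d] that by (intro power_mono) auto
    also have "\<dots> = c1 * \<bar>d\<bar> ^ 3" by (simp add: c1_def power_mult_distrib)
    also have "\<dots> \<le> c1 * \<bar>d\<bar>\<^sup>2" using that c0 by (intro mult_left_mono power_decreasing) auto
    also have "\<dots> \<le> D * d\<^sup>2" using c0 by (auto intro!: mult_right_mono simp: D_def)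
    finally show ?thesis using True by simp
  next
    case False
    let ?Q = "Q j (real (Suc i) + d)"
    have "?Q\<^sup>2 \<le> (B\<^sup>2)\<^sup>2" using Q2(2)[OF that(1,2) False that(3)] Q0 by (intro power_mono) auto
    then have "?Q\<^sup>2 \<le> B ^ 4" by simp
    then have "3 - 3 * ?Q + ?Q\<^sup>2 \<le> 3 + B ^ 4" using Q0[of j "real (Suc i) + d"] by linarith
    then have "L j (real (Suc i) + d) \<le> (B\<^sup>2 * d\<^sup>2) * (3 + B ^ 4)"
      unfolding L_def using Q2(1)[OF that(1,2) False that(3)] pos3 Q0 by (intro mult_mono) auto
    also have "\<dots> = c2 * d\<^sup>2" by (simp add: c2_def)
    also have "\<dots> \<le> D * d\<^sup>2" using c0 by (auto intro!: mult_right_mono simp: D_def)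
    finally show ?thesis using False L0[of j] by simp
  qed
  have \<omega>B: "\<omega> (real (Suc i) + d) \<le> D * d\<^sup>2" if "i < N" "\<bar>d\<bar> \<le> 1" for i d
  proof -
    let ?s = "real (Suc i) + d"
    have "\<omega> ?s = (1 - Q i ?s)\<^sup>2 * (\<Prod>j\<in>{..<N} - {i}. (1 - Q j ?s)\<^sup>2)"
      unfolding \<omega>_def using that by (intro prod.remove) auto
    also have "\<dots> \<le> (K\<^sup>2 * d\<^sup>2) * ((1 + B\<^sup>2)\<^sup>2) ^ N"
    proof (rule mult_mono)
      have "\<bar>Q i ?s - 1\<bar>\<^sup>2 \<le> (K * \<bar>d\<bar>)\<^sup>2" using Q1[OF that] by (intro power_mono) auto
      then show "(1 - Q i ?s)\<^sup>2 \<le> K\<^sup>2 * d\<^sup>2" by (simp add: power_mult_distrib power2_commute)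
      have "(\<Prod>j\<in>{..<N} - {i}. (1 - Q j ?s)\<^sup>2) \<le> (\<Prod>j\<in>{..<N} - {i}. (1 + B\<^sup>2)\<^sup>2)"
      proof (rule prod_mono, intro conjI)
        fix j assume j: "j \<in> {..<N} - {i}"
        have "\<bar>1 - Q j ?s\<bar> \<le> 1 + B\<^sup>2"
          using Q2(2)[of i j d] j that Q0[of j ?s] by auto
        then show "(1 - Q j ?s)\<^sup>2 \<le> (1 + B\<^sup>2)\<^sup>2"
          by (metis abs_ge_zero power2_abs power_mono)
      qed auto
      also have "\<dots> = ((1 + B\<^sup>2)\<^sup>2) ^ card ({..<N} - {i})" by simp
      also have "\<dots> \<le> ((1 + B\<^sup>2)\<^sup>2) ^ N"
        using card_mono[of "{..<N}" "{..<N} - {i}"] by (intro power_increasing) auto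
      finally show "(\<Prod>j\<in>{..<N} - {i}. (1 - Q j ?s)\<^sup>2) \<le> ((1 + B\<^sup>2)\<^sup>2) ^ N" .
    qed (auto intro!: prod_nonneg)
    also have "\<dots> = c3 * d\<^sup>2" by (simp add: c3_def)
    also have "\<dots> \<le> D * d\<^sup>2" using c0 by (auto intro!: mult_right_mono simp: D_def)
    finally show ?thesis .
  qed
  have lB: "\<bar>l j (real (Suc i) + d) - (if j = i then d\<^sup>2 else 0)\<bar> \<le> D * \<bar>d\<bar> ^ 3"
    if "i < N" "j < N" "\<bar>d\<bar> \<le> 1" for i j d
  proof (cases "j = i")
    case True
    let ?Q = "Q i (real (Suc i) + d)"
    have 1: "\<bar>?Q - 1\<bar> \<le> K * \<bar>d\<bar>" using Q1 that by blast
    have "K * \<bar>d\<bar> \<le> K" using that K0 by (simp add: mult_left_le)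
    then have "\<bar>?Q + 1\<bar> \<le> 2 + K" using 1 by linarith
    then have "\<bar>?Q - 1\<bar> * \<bar>?Q + 1\<bar> \<le> (K * \<bar>d\<bar>) * (2 + K)" using 1 K0 by (intro mult_mono) auto
    then have "d\<^sup>2 * (\<bar>?Q - 1\<bar> * \<bar>?Q + 1\<bar>) \<le> d\<^sup>2 * ((K * \<bar>d\<bar>) * (2 + K))"
      by (intro mult_left_mono) auto
    moreover have "l i (real (Suc i) + d) - d\<^sup>2 = d\<^sup>2 * ((?Q - 1) * (?Q + 1))"
      by (simp add: l_def power2_eq_square algebra_simps)
    moreover have "d\<^sup>2 * ((K * \<bar>d\<bar>) * (2 + K)) = c4 * \<bar>d\<bar> ^ 3"
      by (simp add: c4_def power3_eq_cube power2_eq_square)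
    ultimately have "\<bar>l i (real (Suc i) + d) - d\<^sup>2\<bar> \<le> c4 * \<bar>d\<bar> ^ 3"
      by (simp add: abs_mult)
    also have "\<dots> \<le> D * \<bar>d\<bar> ^ 3" using c0 by (auto intro!: mult_right_mono simp: D_def)
    finally show ?thesis using True by simp
  next
    case False
    let ?Q = "Q j (real (Suc i) + d)"
    have "?Q\<^sup>2 \<le> (B\<^sup>2 * d\<^sup>2)\<^sup>2" using Q2(1)[OF that(1,2) False that(3)] Q0 by (intro power_mono) auto
    then have Q4: "?Q\<^sup>2 \<le> B ^ 4 * \<bar>d\<bar> ^ 4" by (simp add: power_mult_distrib)
    have "\<bar>real (Suc i) + d - real (Suc j)\<bar> \<le> real N + 1" using that by auto
    then have "(real (Suc i) + d - real (Suc j))\<^sup>2 \<le> (real N + 1)\<^sup>2"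
      by (metis abs_ge_zero power2_abs power_mono)
    then have "l j (real (Suc i) + d) \<le> (real N + 1)\<^sup>2 * (B ^ 4 * \<bar>d\<bar> ^ 4)"
      unfolding l_def using Q4 by (intro mult_mono) auto
    also have "\<dots> = c5 * \<bar>d\<bar> ^ 4" by (simp add: c5_def)
    also have "\<dots> \<le> c5 * \<bar>d\<bar> ^ 3" using that c0 by (intro mult_left_mono power_decreasing) auto
    also have "\<dots> \<le> D * \<bar>d\<bar> ^ 3" using c0 by (auto intro!: mult_right_mono simp: D_def)
    finally show ?thesis using False by (simp add: l_def)
  qed
  show ?thesis
  proof (rule that[of W l \<omega> D])
    show "real_polynomial_function (W j)" for j
      unfolding W_def by (intro pf pq' pQ)
    show "real_polynomial_function (l j)" for j
      unfolding l_def by (intro pf pQ)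
    show "real_polynomial_function \<omega>"
      unfolding \<omega>_def by (intro pf pQ) auto
    show "0 \<le> W j s" for j s
      unfolding W_def by (intro mult_nonneg_nonneg pos3) auto
    show "0 \<le> l j s" for j s by (simp add: l_def)
    show "0 \<le> \<omega> s" for s by (auto simp: \<omega>_def intro!: prod_nonneg)
    show "0 \<le> D" using c0 by (simp add: D_def)
  qed (simp_all only: L_W sum1 LB \<omega>B lB)
qed

section \<open>Sweeps of simplices and cones, and their stability\<close>

lemma sum_split_first:
  fixes k0 :: "'n::finite"
  shows "(\<Sum>k\<in>UNIV. f k) = f k0 + (\<Sum>k\<in>-{k0}. f k)"
  by (simp add: sum.remove[of UNIV k0] Compl_eq_Diff_UNIV)

text \<open>
  The coordinate \<open>k0\<close> is set apart: it belongs to the time of a sweep, while the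
  other coordinates of \<open>x\<close>, which will be nonnegative, parametrize the moving piece.
  The reciprocal of the weight is the barycentric coordinate of the vertex \<open>P k0\<close>,
  and \<open>x $ k\<close> over the weight is that of \<open>P k\<close>.
\<close>

definition weight :: "'n \<Rightarrow> real ^ 'n::finite \<Rightarrow> real" where
  "weight k0 x = 1 + (\<Sum>k\<in>-{k0}. x $ k)"

text \<open>
  A point of the simplex with vertices \<open>P k\<close>, plus a point of the cone spanned by the
  \<open>E k\<close>, pushed along \<open>V\<close>. The same nonnegative numbers \<open>x $
  k\<close> serve as projective coordinates in the simplex and as affine coordinates in the cone,
  so bounded and unbounded pieces have one common parameter domain. The push is proportional to
  the weight, that is, every generator, vertex or direction, is pushed at the same speed.
\<close>

definition sweep :: "'n \<Rightarrow> ('n \<Rightarrow> 'a) \<Rightarrow> ('n \<Rightarrow> 'a) \<Rightarrow> 'a \<Rightarrow> real \<Rightarrow> real ^ 'n::finite \<Rightarrow> 'a::real_vector" where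
  "sweep k0 P E V \<theta> x = (P k0 + (\<Sum>k\<in>-{k0}. x $ k *\<^sub>R P k)) /\<^sub>R weight k0 x
     + (\<Sum>k\<in>-{k0}. x $ k *\<^sub>R E k) + (\<theta> * weight k0 x) *\<^sub>R V"

text \<open>
  For data with either \<open>E k = 0\<close> or \<open>P k = P k0\<close> for each
  \<open>k\<close>, the sweep is affine in better coordinates: \<open>z $ k\<close> is the
  barycentric coordinate of \<open>P k\<close> or the coefficient of \<open>E k\<close>, and
  \<open>z $ k0\<close> is the height along \<open>V\<close>.
\<close>

definition frame :: "'n \<Rightarrow> ('n \<Rightarrow> 'a) \<Rightarrow> ('n \<Rightarrow> 'a) \<Rightarrow> 'a \<Rightarrow> real ^ 'n::finite \<Rightarrow> 'a::real_vector" where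
  "frame k0 P E V z = (\<Sum>k\<in>-{k0}. z $ k *\<^sub>R (E k + (P k - P k0))) + z $ k0 *\<^sub>R V"

lemma linear_frame:
  fixes k0 :: "'n::finite"
  shows "linear (frame k0 P E V)"
proof (rule linearI)
  fix x y :: "real ^ 'n" and c :: real
  show "frame k0 P E V (x + y) = frame k0 P E V x + frame k0 P E V y"
    unfolding frame_def vector_add_component scaleR_add_left sum.distrib by (simp add: add_ac)
  show "frame k0 P E V (c *\<^sub>R x) = c *\<^sub>R frame k0 P E V x"
    unfolding frame_def vector_scaleR_component scaleR_add_right[of c] scaleR_sum_right by simp
qed

lemma weight_ge_1:
  assumes "\<And>k. k \<noteq> k0 \<Longrightarrow> 0 \<le> x $ k"
  shows "1 \<le> weight k0 x"
proof -
  have "0 \<le> (\<Sum>k\<in>-{k0}. x $ k)" by (rule sum_nonneg) (use assms in auto)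
  then show ?thesis by (simp add: weight_def)
qed

text \<open>
  The change of coordinates between the two descriptions. The set \<open>J\<close> contains the
  indices of directions; \<open>c0\<close> is the barycentric coordinate of \<open>P k0\<close>,
  so the formula makes sense only where \<open>c0 > 0\<close>.
\<close>

lemma sweep_eq_frame:
  fixes w :: "real ^ 'n::finite"
  assumes J: "J \<subseteq> -{k0}" "\<And>k. k \<in> J \<Longrightarrow> P k = P k0" "\<And>k. k \<notin> J \<Longrightarrow> E k = 0"
  defines "c0 \<equiv> 1 - (\<Sum>k\<in>-{k0}-J. w $ k)" and "S \<equiv> 1 + (\<Sum>k\<in>J. w $ k)"
  defines "x \<equiv> (\<chi> k. if k \<in> J then w $ k else if k = k0 then 0 else w $ k * S / c0)"
  assumes pos: "c0 > 0" "S > 0"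
  shows "weight k0 x = S / c0"
    and "sweep k0 P E V (w $ k0 * c0 / S) x = P k0 + frame k0 P E V w"
proof -
  have split: "(\<Sum>k\<in>-{k0}. f k) = (\<Sum>k\<in>J. f k) + (\<Sum>k\<in>-{k0}-J. f k)" for f :: "'n \<Rightarrow> 'b::comm_monoid_add"
    using J(1) by (metis add.commute finite sum.subset_diff)
  have xJ: "x $ k = w $ k" if "k \<in> J" for k using that by (simp add: x_def)
  have xO: "x $ k = w $ k * (S / c0)" if "k \<in> -{k0}-J" for k using that by (auto simp: x_def)
  have "weight k0 x = 1 + (\<Sum>k\<in>J. w $ k) + (\<Sum>k\<in>-{k0}-J. w $ k * (S / c0))"
    unfolding weight_def split using sum.cong[OF refl xJ, of J id] sum.cong[OF refl xO, of "-{k0}-J" id]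
    by simp
  also have "\<dots> = S + (1 - c0) * (S / c0)"
    unfolding sum_distrib_right[symmetric] by (simp add: S_def c0_def)
  also have "\<dots> = S / c0" using pos by (simp add: field_simps)
  finally show w: "weight k0 x = S / c0" .
  have e1: "(\<Sum>k\<in>-{k0}. x $ k *\<^sub>R E k) = (\<Sum>k\<in>J. w $ k *\<^sub>R (E k + (P k - P k0)))"
    unfolding split using J by (simp add: xJ)
  have "(\<Sum>k\<in>-{k0}. x $ k *\<^sub>R P k)
      = (\<Sum>k\<in>J. w $ k *\<^sub>R P k0) + (\<Sum>k\<in>-{k0}-J. (w $ k * (S / c0)) *\<^sub>R P k)"
    unfolding split using J by (simp add: xJ xO)
  then have "P k0 + (\<Sum>k\<in>-{k0}. x $ k *\<^sub>R P k)
      = S *\<^sub>R P k0 + (S / c0) *\<^sub>R (\<Sum>k\<in>-{k0}-J. w $ k *\<^sub>R P k)"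
    by (simp add: S_def scaleR_add_left scaleR_sum_left scaleR_sum_right mult.commute)
  then have "(P k0 + (\<Sum>k\<in>-{k0}. x $ k *\<^sub>R P k)) /\<^sub>R weight k0 x
      = c0 *\<^sub>R P k0 + (\<Sum>k\<in>-{k0}-J. w $ k *\<^sub>R P k)"
    using pos by (simp add: w scaleR_add_right)
  also have "\<dots> = P k0 + (\<Sum>k\<in>-{k0}-J. w $ k *\<^sub>R (E k + (P k - P k0)))"
    using J(3) by (simp add: c0_def scaleR_diff_left scaleR_diff_right sum_subtractf scaleR_sum_left)
  finally have e2: "(P k0 + (\<Sum>k\<in>-{k0}. x $ k *\<^sub>R P k)) /\<^sub>R weight k0 x
      = P k0 + (\<Sum>k\<in>-{k0}-J. w $ k *\<^sub>R (E k + (P k - P k0)))" .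
  show "sweep k0 P E V (w $ k0 * c0 / S) x = P k0 + frame k0 P E V w"
    unfolding sweep_def e1 e2 unfolding frame_def split using pos w by simp
qed

text \<open>
  The ideal sweep attains a point of height \<open>\<tau>\<close> where \<open>\<theta>\<close>
  times the weight equals \<open>\<tau>\<close>, so the perturbation \<open>\<Phi>\<close> allowed
  here moves points by at most \<open>\<epsilon> \<tau>\<close>. If the other coordinates of the
  point are at least \<open>\<kappa> \<tau>\<close>, a ball of radius comparable to
  \<open>\<tau>\<close> around it stays inside the domain of the coordinates, and Brouwer's
  theorem on this ball shows that \<open>\<Phi>\<close> attains the point. For height 0 this
  margin is void; this is how the facets of a polyhedron are covered exactly.

  The bound \<open>R\<close> on the height is there to keep the barycentric coordinate
  \<open>c0\<close> away from 0 on that ball. If all indices other than \<open>k0\<close> belong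
  to \<open>J\<close>, then \<open>c0 = 1\<close> throughout and the height may be arbitrary.
\<close>

lemma perturbed_sweep_covers:
  fixes P E :: "'n::finite \<Rightarrow> real ^ 'n" and V :: "real ^ 'n"
  assumes J: "J \<subseteq> -{k0}" "\<And>k. k \<in> J \<Longrightarrow> P k = P k0" "\<And>k. k \<notin> J \<Longrightarrow> E k = 0"
    and inj: "inj (frame k0 P E V)"
    and pos: "\<kappa> > 0" "\<delta> > 0" "A > 0" "R > 0"
  shows "\<exists>\<epsilon>>0. \<forall>\<Phi>.
    continuous_on ({0..3*A} \<times> {x. \<forall>k. 0 \<le> x $ k}) (\<lambda>(\<theta>, x). \<Phi> \<theta> x) \<longrightarrow>
    (\<forall>\<theta>\<in>{0..3*A}. \<forall>x. (\<forall>k. 0 \<le> x $ k) \<longrightarrow>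
        norm (\<Phi> \<theta> x - sweep k0 P E V \<theta> x) \<le> \<epsilon> * (\<theta> * weight k0 x)) \<longrightarrow>
    (\<forall>z. 0 \<le> z $ k0 \<longrightarrow> (\<forall>k. k \<noteq> k0 \<longrightarrow> \<kappa> * z $ k0 \<le> z $ k) \<longrightarrow>
        2 * \<delta> \<le> 1 - (\<Sum>k\<in>-{k0}-J. z $ k) \<longrightarrow> z $ k0 \<le> A * (1 + (\<Sum>k\<in>J. z $ k)) \<longrightarrow>
        (J = -{k0} \<or> z $ k0 \<le> R) \<longrightarrow>
      (\<exists>\<theta>\<in>{0..3*A}. \<exists>x. (\<forall>k. 0 \<le> x $ k) \<and> \<Phi> \<theta> x = P k0 + frame k0 P E V z))"
proof -
  let ?L = "frame k0 P E V"
  have linL: "linear ?L" by (rule linear_frame)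
  obtain L' where L': "linear L'" "\<And>x. L' (?L x) = x" "\<And>x. ?L (L' x) = x"
    using linear_injective_isomorphism[OF linL inj] by blast
  obtain B where B: "B > 0" "\<And>x. norm (L' x) \<le> B * norm x"
    using linear_bounded_pos[OF L'(1)] by blast
  define N where "N = real CARD('n)"
  have N: "N \<ge> 1" unfolding N_def using zero_less_card_finite[where 'a='n] by linarith
  (* The radius of the ball is \<open>\<mu>\<close> times the height. The four bounds keep, in this order, the coordinates
     nonnegative, the height comparable, \<open>c0\<close> above \<open>\<delta>\<close>, and \<open>S\<close> above half of its value at the centre. *)
  define \<mu> where "\<mu> = min (min \<kappa> (1/2)) (min (\<delta> / (N * R)) (1 / (2 * N * A)))"
  have \<mu>: "\<mu> > 0" "\<mu> \<le> \<kappa>" "\<mu> \<le> 1/2" "\<mu> \<le> \<delta> / (N * R)" "\<mu> \<le> 1 / (2 * N * A)"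
    unfolding \<mu>_def using pos N by (simp_all only: min_le_iff_disj order_refl disj_comms) simp_all
  have \<mu>R: "N * \<mu> * R \<le> \<delta>" and \<mu>A: "N * \<mu> * A \<le> 1/2"
    using \<mu>(4,5) pos N by (simp_all add: field_simps)
  define \<epsilon> where "\<epsilon> = \<mu> / (2 * B)"
  have \<epsilon>: "\<epsilon> > 0" using \<mu> B by (simp add: \<epsilon>_def)
  show ?thesis
  proof (intro exI[of _ \<epsilon>] conjI \<epsilon> allI impI)
    fix \<Phi> :: "real \<Rightarrow> real ^ 'n \<Rightarrow> real ^ 'n" and z :: "real ^ 'n"
    assume cont: "continuous_on ({0..3*A} \<times> {x. \<forall>k. 0 \<le> x $ k}) (\<lambda>(\<theta>, x). \<Phi> \<theta> x)"
      and near: "\<forall>\<theta>\<in>{0..3*A}. \<forall>x. (\<forall>k. 0 \<le> x $ k) \<longrightarrow>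
        norm (\<Phi> \<theta> x - sweep k0 P E V \<theta> x) \<le> \<epsilon> * (\<theta> * weight k0 x)"
      and z0: "0 \<le> z $ k0" and z1: "\<forall>k. k \<noteq> k0 \<longrightarrow> \<kappa> * z $ k0 \<le> z $ k"
      and z2: "2 * \<delta> \<le> 1 - (\<Sum>k\<in>-{k0}-J. z $ k)"
      and z3: "z $ k0 \<le> A * (1 + (\<Sum>k\<in>J. z $ k))"
      and z4: "J = -{k0} \<or> z $ k0 \<le> R"
    define c0 where "c0 w = 1 - (\<Sum>k\<in>-{k0}-J. w $ k)" for w :: "real ^ 'n"
    define S where "S w = 1 + (\<Sum>k\<in>J. w $ k)" for w :: "real ^ 'n"
    define X where "X w = (\<chi> k. if k \<in> J then w $ k else if k = k0 then 0 else w $ k * S w / c0 w)"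
      for w :: "real ^ 'n"
    define T where "T w = w $ k0 * c0 w / S w" for w :: "real ^ 'n"
    have zpos: "0 \<le> z $ k" for k
      using z1 z0 pos(1) by (cases "k = k0") (auto intro: order_trans[of 0 "\<kappa> * z $ k0"])
    have Sz: "S z \<ge> 1" unfolding S_def using zpos by (simp add: sum_nonneg)
    define \<rho> where "\<rho> = \<mu> * z $ k0"
    have \<rho>0: "\<rho> \<ge> 0" using \<mu> z0 by (simp add: \<rho>_def)
    have card_le: "real (card M) \<le> N" for M :: "'n set"
      unfolding N_def by (simp add: card_mono)
    have ball: "(\<forall>k. 0 \<le> w $ k) \<and> w $ k0 \<le> 3/2 * z $ k0 \<and> \<delta> \<le> c0 w \<and> c0 w \<le> 1 \<and>
        S z / 2 \<le> S w \<and> T w \<in> {0..3*A} \<and> (\<forall>k. 0 \<le> X w $ k)"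
      if w: "w \<in> cball z \<rho>" for w
    proof -
      have comp: "\<bar>w $ k - z $ k\<bar> \<le> \<rho>" for k
        using w component_le_norm_cart[of "w - z" k] by (simp add: dist_norm norm_minus_commute)
      have sums: "\<bar>(\<Sum>k\<in>M. w $ k) - (\<Sum>k\<in>M. z $ k)\<bar> \<le> N * \<rho>" for M
      proof -
        have "\<bar>(\<Sum>k\<in>M. w $ k) - (\<Sum>k\<in>M. z $ k)\<bar> \<le> (\<Sum>k\<in>M. \<bar>w $ k - z $ k\<bar>)"
          unfolding sum_subtractf[symmetric] by (rule sum_abs)
        also have "\<dots> \<le> real (card M) * \<rho>" using comp by (intro sum_bounded_above) auto
        also have "\<dots> \<le> N * \<rho>" using card_le \<rho>0 by (intro mult_right_mono)
        finally show ?thesis .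
      qed
      have half: "\<rho> \<le> z $ k0 / 2"
        unfolding \<rho>_def using \<mu>(3) z0 mult_right_mono[of \<mu> "1/2" "z $ k0"] by simp
      have w0: "0 \<le> w $ k" for k
      proof (cases "k = k0")
        case True then show ?thesis using comp[of k] half z0 by auto
      next
        case False
        have "\<rho> \<le> \<kappa> * z $ k0" unfolding \<rho>_def using \<mu>(2) z0 by (intro mult_right_mono)
        then show ?thesis using comp[of k] z1 False by fastforce
      qed
      have wk0: "w $ k0 \<le> 3/2 * z $ k0" using comp[of k0] half by linarith
      have c1: "\<delta> \<le> c0 w"
        using z4
      proof
        assume "J = -{k0}"
        then show ?thesis using z2 pos(2) by (simp add: c0_def)
      next
        assume "z $ k0 \<le> R"
        then have "N * \<rho> \<le> N * \<mu> * R" unfolding \<rho>_def using N \<mu>(1) by (simp add: mult_left_mono)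
        then have "N * \<rho> \<le> \<delta>" using \<mu>R by linarith
        then show ?thesis using sums[of "-{k0}-J"] z2 unfolding c0_def by linarith
      qed
      have c2: "c0 w \<le> 1" unfolding c0_def using w0 by (simp add: sum_nonneg)
      have "N * \<rho> \<le> N * \<mu> * (A * S z)"
        unfolding \<rho>_def using z3 N \<mu>(1) by (simp add: S_def mult_left_mono)
      also have "\<dots> \<le> 1/2 * S z" using \<mu>A Sz mult_right_mono[of "N * \<mu> * A" "1/2" "S z"] by (simp add: mult.assoc)
      finally have Sw: "S z / 2 \<le> S w" using abs_le_D2[OF sums[of J]] by (simp add: S_def field_simps)
      then have Sw0: "S w > 0" using Sz by linarith
      have "T w \<le> 3/2 * z $ k0 * 1 / (S z / 2)"
        unfolding T_def using wk0 c2 Sw Sz w0 c1 pos(2) z0 by (intro frac_le mult_mono) auto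
      also have "\<dots> \<le> 3 * A" using z3 Sz by (simp add: S_def field_simps)
      finally have "T w \<le> 3 * A" .
      moreover have "0 \<le> T w" unfolding T_def using w0 c1 pos(2) Sw0 by simp
      moreover have "0 \<le> X w $ k" for k
        unfolding X_def using w0 c1 pos(2) Sw0 by simp
      ultimately show ?thesis using w0 wk0 c1 c2 Sw by auto
    qed
    have ident: "weight k0 (X w) = S w / c0 w" "sweep k0 P E V (T w) (X w) = P k0 + ?L w"
      if "w \<in> cball z \<rho>" for w
    proof -
      have *: "0 < c0 w" "0 < S w" using ball[OF that] pos(2) Sz by auto
      show "weight k0 (X w) = S w / c0 w"
        unfolding X_def c0_def S_def
        by (rule sweep_eq_frame(1)[where P=P and E=E])
          (use J * in \<open>simp_all only: c0_def S_def\<close>)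
      show "sweep k0 P E V (T w) (X w) = P k0 + ?L w"
        unfolding X_def T_def c0_def S_def
        by (rule sweep_eq_frame(2))
          (use J * in \<open>simp_all only: c0_def S_def\<close>)
    qed
    have err: "norm (\<Phi> (T w) (X w) - (P k0 + ?L w)) \<le> \<epsilon> * w $ k0" if w: "w \<in> cball z \<rho>" for w
    proof -
      have "T w * weight k0 (X w) = w $ k0"
        using ident(1)[OF w] ball[OF w] pos(2) Sz unfolding T_def by simp
      then show ?thesis using near ball[OF w] ident(2)[OF w] by metis
    qed
    (* A fixed point of \<open>f\<close> is a parameter \<open>w\<close> at which \<open>\<Phi>\<close> takes the value with coordinates \<open>z\<close>. *)
    define f where "f w = z - L' (\<Phi> (T w) (X w) - (P k0 + ?L w))" for w
    have contc: "continuous_on (cball z \<rho>) c0" "continuous_on (cball z \<rho>) S"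
      unfolding c0_def S_def by (intro continuous_intros)+
    have ne: "c0 w \<noteq> 0" "S w \<noteq> 0" if "w \<in> cball z \<rho>" for w
      using ball[OF that] pos(2) Sz by auto
    have contT: "continuous_on (cball z \<rho>) T"
      unfolding T_def using ne by (intro continuous_intros contc) auto
    have contX: "continuous_on (cball z \<rho>) X"
      unfolding X_def
    proof (rule continuous_on_vec_lambda)
      fix k
      show "continuous_on (cball z \<rho>) (\<lambda>w. if k \<in> J then w $ k else if k = k0 then 0 else w $ k * S w / c0 w)"
        using ne by (cases "k \<in> J"; cases "k = k0") (auto intro!: continuous_intros contc)
    qed
    have "continuous_on (cball z \<rho>) (\<lambda>w. (\<lambda>(\<theta>, x). \<Phi> \<theta> x) (T w, X w))"
      by (rule continuous_on_compose2[OF cont continuous_on_Pair[OF contT contX]]) (use ball in auto)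
    then have cont\<Phi>: "continuous_on (cball z \<rho>) (\<lambda>w. \<Phi> (T w) (X w))" by simp
    have contf: "continuous_on (cball z \<rho>) f"
      unfolding f_def
      by (intro continuous_intros cont\<Phi> linear_continuous_on_compose[OF _ L'(1)]
          linear_continuous_on_compose[OF continuous_on_id linL])
    have self: "f w \<in> cball z \<rho>" if w: "w \<in> cball z \<rho>" for w
    proof -
      let ?e = "\<Phi> (T w) (X w) - (P k0 + ?L w)"
      have "norm (L' ?e) \<le> B * (\<epsilon> * w $ k0)"
        using B(2)[of ?e] err[OF w] B(1) by (meson mult_left_mono order_trans less_imp_le)
      also have "\<dots> = \<mu> / 2 * w $ k0" using B(1) by (simp add: \<epsilon>_def)
      also have "\<dots> \<le> \<mu> / 2 * (3/2 * z $ k0)" using ball[OF w] \<mu>(1) by (intro mult_left_mono) auto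
      also have "\<dots> \<le> \<rho>" using \<mu>(1) z0 by (simp add: \<rho>_def)
      finally show ?thesis
        by (simp add: f_def dist_norm)
    qed
    show "\<exists>\<theta>\<in>{0..3*A}. \<exists>x. (\<forall>k. 0 \<le> x $ k) \<and> \<Phi> \<theta> x = P k0 + ?L z"
    proof (cases "z $ k0 = 0")
      case True
      have "z \<in> cball z \<rho>" using \<rho>0 by simp
      moreover from this have "\<Phi> (T z) (X z) = P k0 + ?L z" using err[of z] True by simp
      ultimately show ?thesis using ball by metis
    next
      case False
      then have "\<rho> > 0" using z0 \<mu>(1) by (simp add: \<rho>_def)
      then obtain w where w: "w \<in> cball z \<rho>" "f w = w"
        using brouwer_ball[OF _ contf] self by blast
      let ?e = "\<Phi> (T w) (X w) - (P k0 + ?L w)"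
      have "?L w = ?L (z - L' ?e)" using w(2) by (simp add: f_def)
      also have "\<dots> = ?L z - ?e" using L'(3) by (simp add: linear_diff[OF linL])
      finally have "\<Phi> (T w) (X w) = P k0 + ?L z" by (simp add: algebra_simps)
      then show ?thesis using ball[OF w(1)] by blast
    qed
  qed
qed

section \<open>Sweeps inside a convex set\<close>

lemma sweep_alt:
  assumes "weight k0 x \<noteq> 0"
  shows "sweep k0 P E V \<theta> x = P k0 + (\<Sum>k\<in>-{k0}. (x $ k / weight k0 x) *\<^sub>R (P k - P k0))
    + (\<Sum>k\<in>-{k0}. x $ k *\<^sub>R E k) + (\<theta> * weight k0 x) *\<^sub>R V"
proof -
  let ?w = "weight k0 x"
  have "(P k0 + (\<Sum>k\<in>-{k0}. x $ k *\<^sub>R P k))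
      = ?w *\<^sub>R P k0 + (\<Sum>k\<in>-{k0}. x $ k *\<^sub>R (P k - P k0))"
    by (simp add: weight_def scaleR_add_left scaleR_diff_right sum_subtractf scaleR_sum_left)
  then have "(P k0 + (\<Sum>k\<in>-{k0}. x $ k *\<^sub>R P k)) /\<^sub>R ?w
      = P k0 + (\<Sum>k\<in>-{k0}. (x $ k / ?w) *\<^sub>R (P k - P k0))"
    using assms by (simp add: scaleR_add_right scaleR_sum_right divide_inverse mult.commute)
  then show ?thesis by (simp add: sweep_def)
qed

lemma sweep_cong:
  assumes "\<And>k. k \<noteq> k0 \<Longrightarrow> x $ k = x' $ k"
  shows "sweep k0 P E V \<theta> x = sweep k0 P E V \<theta> x'"
proof -
  have "weight k0 x = weight k0 x'"
    unfolding weight_def using assms by (auto intro!: sum.cong)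
  moreover have "(\<Sum>k\<in>-{k0}. x $ k *\<^sub>R Q k) = (\<Sum>k\<in>-{k0}. x' $ k *\<^sub>R Q k)" for Q :: "'a \<Rightarrow> 'b"
    using assms by (intro sum.cong) auto
  ultimately show ?thesis by (simp add: sweep_def)
qed

lemma sweep_diff:
  "sweep k0 P E V \<theta> x - sweep k0 P' E' V' \<theta>' x
    = sweep k0 (\<lambda>k. P k - P' k) (\<lambda>k. E k - E' k) (\<theta> *\<^sub>R V - \<theta>' *\<^sub>R V') 1 x"
  by (simp add: sweep_def scaleR_diff_right sum_subtractf scaleR_add_right mult.commute algebra_simps)

lemma continuous_on_sweep:
  fixes P E :: "'b::topological_space \<Rightarrow> 'n::finite \<Rightarrow> 'a::real_normed_vector"
  assumes P: "\<And>k. continuous_on S (\<lambda>y. P y k)" and E: "\<And>k. continuous_on S (\<lambda>y. E y k)"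
    and V: "continuous_on S V" and x: "continuous_on S x" and pos: "\<And>y k. y \<in> S \<Longrightarrow> 0 \<le> x y $ k"
  shows "continuous_on S (\<lambda>y. sweep k0 (P y) (E y) (V y) \<theta> (x y))"
proof -
  have cx: "continuous_on S (\<lambda>y. x y $ k)" for k using x by (rule continuous_on_component)
  have cw: "continuous_on S (\<lambda>y. weight k0 (x y))"
    unfolding weight_def by (intro continuous_on_add continuous_on_sum continuous_on_const cx)
  have "\<forall>y\<in>S. weight k0 (x y) \<noteq> 0"
    using weight_ge_1[of k0 "x _"] pos by fastforce
  then have ci: "continuous_on S (\<lambda>y. inverse (weight k0 (x y)))"
    by (intro continuous_on_inverse cw)
  show ?thesis
    unfolding sweep_def
    by (intro continuous_on_add continuous_on_sum continuous_on_scaleR continuous_on_mult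
        continuous_on_const ci cw cx P E V)
qed

lemma norm_sweep_le:
  fixes P E :: "'n::finite \<Rightarrow> 'a::real_normed_vector"
  assumes x: "\<And>k. 0 \<le> x $ k" and a: "\<And>k. norm (P k) \<le> a" and b: "\<And>k. norm (E k) \<le> b"
    and c: "norm V \<le> c" 
  shows "norm (sweep k0 P E V 1 x) \<le> (a + b + c) * weight k0 x"
proof -
  let ?w = "weight k0 x"
  have w: "1 \<le> ?w" using x by (intro weight_ge_1)
  have S: "norm (\<Sum>k\<in>-{k0}. x $ k *\<^sub>R Q k) \<le> (?w - 1) * r"
    if "\<And>k. norm (Q k) \<le> r" for Q :: "'n \<Rightarrow> 'a" and r
  proof -
    have "norm (\<Sum>k\<in>-{k0}. x $ k *\<^sub>R Q k) \<le> (\<Sum>k\<in>-{k0}. x $ k * r)"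
      using that x by (intro sum_norm_le) (simp add: mult_left_mono)
    then show ?thesis unfolding sum_distrib_right[symmetric] by (simp add: weight_def)
  qed
  have "0 \<le> a" "0 \<le> b" using a[of k0] b[of k0] norm_ge_zero order_trans by blast+
  have "norm (P k0 + (\<Sum>k\<in>-{k0}. x $ k *\<^sub>R P k)) \<le> ?w * a"
    using norm_triangle_le[OF add_mono[OF a[of k0] S[of P a, OF a]]] by (simp add: algebra_simps)
  then have "norm ((P k0 + (\<Sum>k\<in>-{k0}. x $ k *\<^sub>R P k)) /\<^sub>R ?w) \<le> a"
    unfolding norm_scaleR using w by (simp add: inverse_eq_divide divide_le_eq mult.commute)
  also have "\<dots> \<le> a * ?w" using \<open>0 \<le> a\<close> w by (simp add: mult_le_cancel_left1)
  finally have 1: "norm ((P k0 + (\<Sum>k\<in>-{k0}. x $ k *\<^sub>R P k)) /\<^sub>R ?w) \<le> a * ?w" .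
  have "(?w - 1) * b \<le> b * ?w" using \<open>0 \<le> b\<close> by (simp add: algebra_simps)
  then have 2: "norm (\<Sum>k\<in>-{k0}. x $ k *\<^sub>R E k) \<le> b * ?w" using S[of E b, OF b] by linarith
  have 3: "norm ((1 * ?w) *\<^sub>R V) \<le> c * ?w" using c w by (simp add: mult.commute)
  show ?thesis unfolding sweep_def distrib_right
    by (intro norm_triangle_le add_mono 1 2 3)
qed

text \<open>
  The part of the relation between a convex set and its recession cone that keeps sweeps inside
  the convex set.
\<close>

locale convex_with_recession =
  fixes K C :: "'a::real_vector set"
  assumes convex_K: "convex K"
    and cone_add: "\<lbrakk>x \<in> C; y \<in> C\<rbrakk> \<Longrightarrow> x + y \<in> C"
    and cone_scale: "\<lbrakk>x \<in> C; 0 \<le> r\<rbrakk> \<Longrightarrow> r *\<^sub>R x \<in> C"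
    and zero_in_C: "0 \<in> C"
    and add_K: "\<lbrakk>p \<in> K; x \<in> C\<rbrakk> \<Longrightarrow> p + x \<in> K"
begin

lemma cone_sum:
  assumes "\<And>i. i \<in> I \<Longrightarrow> y i \<in> C" "\<And>i. i \<in> I \<Longrightarrow> 0 \<le> r i"
  shows "(\<Sum>i\<in>I. r i *\<^sub>R y i) \<in> C"
  using assms by (induction I rule: infinite_finite_induct) (auto intro: cone_add cone_scale zero_in_C)

lemma convex_C: "convex C"
  by (auto simp: convex_def intro!: cone_add cone_scale)

text \<open>
  A convex combination of points of \<open>K\<close> plus vectors of \<open>C\<close>.
\<close>

lemma sweep_in:
  assumes "\<And>k. P k \<in> K" "\<And>k. E k \<in> C" "V \<in> C" "0 \<le> \<theta>" and x: "\<And>k. 0 \<le> x $ k"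
  shows "sweep k0 P E V \<theta> x \<in> K"
proof -
  let ?w = "weight k0 x"
  have w: "1 \<le> ?w" using x by (intro weight_ge_1)
  define r where "r k = (if k = k0 then 1 else x $ k) / ?w" for k
  have "(\<Sum>k\<in>UNIV. r k *\<^sub>R P k) \<in> K"
  proof (rule convex_sum)
    have "(\<Sum>k\<in>-{k0}. r k) = (\<Sum>k\<in>-{k0}. x $ k) / ?w"
      unfolding sum_divide_distrib by (intro sum.cong) (auto simp: r_def)
    then show "sum r UNIV = 1"
      unfolding sum_split_first[of _ k0] using w by (simp add: r_def weight_def add_divide_distrib[symmetric])
  qed (use assms w convex_K in \<open>auto simp: r_def\<close>)
  moreover have "(\<Sum>k\<in>UNIV. r k *\<^sub>R P k) = (P k0 + (\<Sum>k\<in>-{k0}. x $ k *\<^sub>R P k)) /\<^sub>R ?w"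
  proof -
    have "(\<Sum>k\<in>-{k0}. r k *\<^sub>R P k) = (\<Sum>k\<in>-{k0}. x $ k *\<^sub>R P k) /\<^sub>R ?w"
      unfolding scaleR_sum_right by (intro sum.cong) (auto simp: r_def divide_inverse mult.commute)
    then show ?thesis
      unfolding sum_split_first[of _ k0] by (simp add: r_def scaleR_add_right divide_inverse)
  qed
  ultimately show ?thesis unfolding sweep_def
    using assms w by (auto intro!: add_K cone_sum cone_scale)
qed

text \<open>
  Weights with a sum above 1 are harmless if the surplus is compensated in a direction
  \<open>u\<close> that moves all points involved into \<open>C\<close>: with the mean
  \<open>m\<close> of the points and the total weight \<open>T\<close>, the vector in question is
  \<open>m + (T - 1) (m + u)\<close>.
\<close>

lemma overweight_combination_in:
  assumes "finite I" and "\<And>i. i \<in> I \<Longrightarrow> p i \<in> K" and "\<And>i. i \<in> I \<Longrightarrow> p i + u \<in> C"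
    and "\<And>i. i \<in> I \<Longrightarrow> 0 \<le> c i" and T: "1 \<le> sum c I"
  shows "(\<Sum>i\<in>I. c i *\<^sub>R p i) + (sum c I - 1) *\<^sub>R u \<in> K"
proof -
  define T where "T = sum c I"
  have T1: "1 \<le> T" using T by (simp add: T_def)
  have one: "(\<Sum>i\<in>I. c i / T) = 1" using T1 by (simp add: sum_divide_distrib[symmetric] T_def)
  define m where "m = (\<Sum>i\<in>I. (c i / T) *\<^sub>R p i)"
  have "m \<in> K" unfolding m_def
    using assms one T1 convex_K by (intro convex_sum) auto
  have "(\<Sum>i\<in>I. (c i / T) *\<^sub>R (p i + u)) \<in> C"
    using assms T1 by (intro cone_sum) auto
  moreover have "(\<Sum>i\<in>I. (c i / T) *\<^sub>R (p i + u)) = m + u"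
    using one by (simp add: m_def scaleR_add_right sum.distrib scaleR_sum_left[symmetric])
  ultimately have "m + (T - 1) *\<^sub>R (m + u) \<in> K"
    using \<open>m \<in> K\<close> T1 by (intro add_K cone_scale) auto
  moreover have "(\<Sum>i\<in>I. c i *\<^sub>R p i) = T *\<^sub>R m"
    using T1 by (simp add: m_def scaleR_sum_right)
  ultimately show ?thesis by (simp add: T_def[symmetric] algebra_simps)
qed

end

section \<open>A polynomial map that imitates finitely many sweeps\<close>

text \<open>
  Let the vertices and directions of a sweep move along polynomial paths \<open>A\<close> in
  \<open>K\<close> and \<open>B\<close> in \<open>C\<close>, depending on a time \<open>s\<close>,
  and push by \<open>U s\<close>. In terms of \<open>z\<close>, put \<open>x $ k = (z $
  k)\<^sup>2\<close> and let \<open>s\<close> be \<open>z $ k0\<close> times the weight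
  \<open>w\<close> of \<open>x\<close>. Then the denominator \<open>w\<close> disappears: it
  divides only terms that carry a factor \<open>s\<^sup>2\<close>, and \<open>s\<^sup>2 / w = z $
  k0 * s\<close>. Convexity keeps this polynomial map in \<open>K\<close> for all
  \<open>z\<close>.

  At time \<open>i + 1 + d\<close> the paths are at the data of sweep \<open>i\<close>, up to
  errors of order \<open>d\<^sup>2\<close>, and the push is \<open>m\<^sup>2 d\<^sup>2\<close>
  times \<open>V i\<close>, up to an error of order \<open>m\<^sup>2 d\<^sup>3\<close>. With
  \<open>\<theta> = m\<^sup>2 d\<^sup>2\<close> both errors are of size \<open>\<theta> /
  m\<close>, so a large \<open>m\<close> gives the relative precision \<open>\<epsilon>\<close>
  for all \<open>\<theta>\<close> up to \<open>\<Theta>\<close>.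
\<close>

lemma polynomial_map_near_sweeps:
  fixes P E :: "nat \<Rightarrow> 'n::finite \<Rightarrow> 'a::euclidean_space" and K C :: "'a set" and V :: "nat \<Rightarrow> 'a"
  assumes KC: "convex_with_recession K C"
    and P: "\<And>i k. i < N \<Longrightarrow> P i k \<in> K" and E: "\<And>i k. i < N \<Longrightarrow> E i k \<in> C"
    and V: "\<And>i. i < N \<Longrightarrow> V i \<in> C"
    and p: "p \<in> K" and u: "u \<in> C" "p + u \<in> C" "\<And>i k. i < N \<Longrightarrow> P i k + u \<in> C"
    and \<epsilon>: "\<epsilon> > 0" and \<Theta>: "\<Theta> \<ge> 0"
  obtains f :: "real ^ 'n \<Rightarrow> 'a" and \<Phi>
  where "polynomial_function f" "range f \<subseteq> K"
    "\<And>i. i < N \<Longrightarrow> continuous_on ({0..\<Theta>} \<times> {x. \<forall>k. 0 \<le> x $ k}) (\<lambda>(\<theta>, x). \<Phi> i \<theta> x)"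
    "\<And>i \<theta> x. \<lbrakk>i < N; \<theta> \<in> {0..\<Theta>}; \<And>k. 0 \<le> x $ k\<rbrakk> \<Longrightarrow> \<Phi> i \<theta> x \<in> range f"
    "\<And>i \<theta> x. \<lbrakk>i < N; \<theta> \<in> {0..\<Theta>}; \<And>k. 0 \<le> x $ k\<rbrakk> \<Longrightarrow>
       norm (\<Phi> i \<theta> x - sweep k0 (P i) (E i) (V i) \<theta> x) \<le> \<epsilon> * (\<theta> * weight k0 x)"
proof -
  interpret convex_with_recession K C by fact
  obtain W l :: "nat \<Rightarrow> real \<Rightarrow> real" and \<omega> :: "real \<Rightarrow> real" and D :: real
  where pW: "\<And>j. real_polynomial_function (W j)" and pl: "\<And>j. real_polynomial_function (l j)"
    and p\<omega>: "real_polynomial_function \<omega>"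
    and W0: "\<And>j s. 0 \<le> W j s" and l0: "\<And>j s. 0 \<le> l j s" and \<omega>0: "\<And>s. 0 \<le> \<omega> s"
    and total: "\<And>s. 1 \<le> (\<Sum>j<N. s\<^sup>2 * W j s) + \<omega> s"
    and D0: "0 \<le> D"
    and nodeW: "\<And>i j d. \<lbrakk>i < N; j < N; \<bar>d\<bar> \<le> 1\<rbrakk> \<Longrightarrow>
      \<bar>(real (Suc i) + d)\<^sup>2 * W j (real (Suc i) + d) - (if j = i then 1 else 0)\<bar> \<le> D * d\<^sup>2"
    and node\<omega>: "\<And>i d. \<lbrakk>i < N; \<bar>d\<bar> \<le> 1\<rbrakk> \<Longrightarrow> \<omega> (real (Suc i) + d) \<le> D * d\<^sup>2"
    and nodel: "\<And>i j d. \<lbrakk>i < N; j < N; \<bar>d\<bar> \<le> 1\<rbrakk> \<Longrightarrow>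
      \<bar>l j (real (Suc i) + d) - (if j = i then d\<^sup>2 else 0)\<bar> \<le> D * \<bar>d\<bar> ^ 3"
    using interpolation_weights[of N] by blast
  define L where "L j s = s\<^sup>2 * W j s" for j s
  define \<eta> where "\<eta> s = (\<Sum>j<N. L j s) + \<omega> s - 1" for s
  define r where "r = sqrt \<Theta>"
  have r0: "r \<ge> 0" using \<Theta> by (simp add: r_def)
  define b where "b = (\<Sum>j<N. \<Sum>k\<in>UNIV. norm (P j k) + norm (E j k)) + (\<Sum>j<N. norm (V j)) + norm p + norm u"
  have b0: "b \<ge> 0" unfolding b_def by (intro add_nonneg_nonneg sum_nonneg) auto
  have bPE: "norm (P j k) + norm (E j k) \<le> b" if "j < N" for j k
  proof -
    have "norm (P j k) + norm (E j k) \<le> (\<Sum>k\<in>UNIV. norm (P j k) + norm (E j k))"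
      by (intro member_le_sum) auto
    also have "\<dots> \<le> (\<Sum>j<N. \<Sum>k\<in>UNIV. norm (P j k) + norm (E j k))"
      using that by (intro member_le_sum) (auto intro!: sum_nonneg)
    also have "\<dots> \<le> b" unfolding b_def by (simp add: sum_nonneg)
    finally show ?thesis .
  qed
  have bV: "norm (V j) \<le> b" if "j < N" for j
  proof -
    have "norm (V j) \<le> (\<Sum>j<N. norm (V j))" using that by (intro member_le_sum) auto
    also have "\<dots> \<le> b" unfolding b_def by (simp add: sum_nonneg add_nonneg_nonneg)
    finally show ?thesis .
  qed
  have bpu: "norm p \<le> b" "norm u \<le> b"
    unfolding b_def by (simp_all add: sum_nonneg add_nonneg_nonneg)
  have bP: "norm (P j k) \<le> b" and bE: "norm (E j k) \<le> b" if "j < N" for j k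
    using bPE[OF that, of k] norm_ge_zero[of "P j k"] norm_ge_zero[of "E j k"] by linarith+
  define c where "c = (5 * real N + 3) * D * b"
  have c0: "c \<ge> 0" using D0 b0 by (simp add: c_def)
  define m where "m = 1 + r + (1 + r) * (c + 1) / \<epsilon>"
  have m1: "m \<ge> 1 + r" using r0 c0 \<epsilon> by (simp add: m_def)
  then have m0: "m > 0" "m \<ge> 1" using r0 by linarith+
  have m_small: "c * ((1 + r) / m) \<le> \<epsilon>"
  proof -
    have "(1 + r) * (c + 1) / \<epsilon> \<le> m" using r0 by (simp add: m_def)
    then have "(1 + r) * (c + 1) \<le> \<epsilon> * m" using \<epsilon> by (simp add: field_simps)
    then have "c * (1 + r) \<le> \<epsilon> * m" using r0 by (simp add: algebra_simps)
    then show ?thesis using m0 by (simp add: field_simps)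
  qed
  define A where "A s k = (\<Sum>j<N. L j s *\<^sub>R P j k) + \<omega> s *\<^sub>R p + \<eta> s *\<^sub>R u" for s k
  define B where "B s k = (\<Sum>j<N. L j s *\<^sub>R E j k)" for s k
  define U where "U s = m\<^sup>2 *\<^sub>R (\<Sum>j<N. l j s *\<^sub>R V j)" for s
  define H where "H s x = sweep k0 (A s) (B s) (U s) 1 x" for s and x :: "real ^ 'n"
  define f where "f z = H (z $ k0 * weight k0 (\<chi> k. (z $ k)\<^sup>2)) (\<chi> k. (z $ k)\<^sup>2)" for z :: "real ^ 'n"
  define \<Phi> where "\<Phi> i \<theta> x = H (real (Suc i) + sqrt \<theta> / m) x" for i \<theta> and x :: "real ^ 'n"
  have L0: "0 \<le> L j s" for j s by (simp add: L_def W0)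
  have AK: "A s k \<in> K" for s k
  proof -
    have "(\<Sum>j\<le>N. (if j < N then L j s else \<omega> s) *\<^sub>R (if j < N then P j k else p))
        + (sum (\<lambda>j. if j < N then L j s else \<omega> s) {..N} - 1) *\<^sub>R u \<in> K"
    proof (rule overweight_combination_in)
      show "1 \<le> (\<Sum>j\<le>N. if j < N then L j s else \<omega> s)"
        using total[of s] by (simp add: lessThan_Suc_atMost[symmetric] L_def)
    qed (use P p u L0 \<omega>0 in auto)
    then show ?thesis
      by (simp add: lessThan_Suc_atMost[symmetric] A_def \<eta>_def)
  qed
  have BC: "B s k \<in> C" for s k
    unfolding B_def using E L0 by (intro cone_sum) auto
  have UC: "U s \<in> C" for s
    unfolding U_def using V l0 by (intro cone_sum cone_scale) auto
  have HK: "H s x \<in> K" if "\<And>k. 0 \<le> x $ k" for s x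
    unfolding H_def using AK BC UC that by (intro sweep_in) auto
  have weight_f: "weight k0 (\<chi> k. (z $ k)\<^sup>2) = 1 + (\<Sum>k\<in>-{k0}. (z $ k)\<^sup>2)" for z :: "real ^ 'n"
    by (simp add: weight_def)
  have \<Phi>_range: "\<Phi> i \<theta> x \<in> range f" if x: "\<And>k. 0 \<le> x $ k" for i \<theta> x
  proof -
    define s where "s = real (Suc i) + sqrt \<theta> / m"
    have w: "weight k0 x \<ge> 1" using x by (intro weight_ge_1)
    (* Any time and any nonnegative \<open>x\<close> come from some \<open>z\<close>, since \<open>z $ k0\<close> is free and the other coordinates enter by their squares. *)
    define z where "z = (\<chi> k. if k = k0 then s / weight k0 x else sqrt (x $ k))"
    define x' where "x' = (\<chi> k. (z $ k)\<^sup>2)"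
    have x': "x' $ k = x $ k" if "k \<noteq> k0" for k using that x by (simp add: x'_def z_def)
    have w': "weight k0 x' = weight k0 x" unfolding weight_def using x' by (auto intro!: sum.cong)
    have "f z = H s x'"
      using w by (simp add: f_def x'_def[symmetric] w') (simp add: z_def)
    also have "\<dots> = H s x" unfolding H_def using x' by (intro sweep_cong) auto
    finally show ?thesis by (metis \<Phi>_def s_def rangeI)
  qed
  have contPhi: "continuous_on ({0..\<Theta>} \<times> {x. \<forall>k. 0 \<le> x $ k}) (\<lambda>(\<theta>, x). \<Phi> i \<theta> x)" for i
  proof -
    let ?S = "{0..\<Theta>} \<times> {x :: real ^ 'n. \<forall>k. 0 \<le> x $ k}"
    have cs: "continuous_on ?S (\<lambda>y. real (Suc i) + sqrt (fst y) / m)"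
      using m0 by (intro continuous_intros) auto
    have cp: "continuous_on ?S (\<lambda>y. g (real (Suc i) + sqrt (fst y) / m))"
      if "real_polynomial_function g" for g
      by (rule continuous_on_compose2[OF _ cs, where t=UNIV])
        (use that in \<open>auto intro: continuous_on_polymonial_function simp: real_polynomial_function_eq\<close>)
    let ?s = "\<lambda>y :: real \<times> (real ^ 'n). real (Suc i) + sqrt (fst y) / m"
    have cL: "continuous_on ?S (\<lambda>y. L j (?s y))" for j
      unfolding L_def by (intro continuous_on_mult continuous_on_power cs cp[OF pW])
    have "continuous_on ?S (\<lambda>y. \<eta> (?s y))"
      unfolding \<eta>_def
      by (intro continuous_on_add continuous_on_diff continuous_on_sum continuous_on_const cL cp[OF p\<omega>])
    then have cA: "continuous_on ?S (\<lambda>y. A (?s y) k)" for k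
      unfolding A_def
      by (intro continuous_on_add continuous_on_sum continuous_on_scaleR continuous_on_const cL cp[OF p\<omega>])
    have cB: "continuous_on ?S (\<lambda>y. B (?s y) k)" for k
      unfolding B_def by (intro continuous_on_sum continuous_on_scaleR continuous_on_const cL)
    have cU: "continuous_on ?S (\<lambda>y. U (?s y))"
      unfolding U_def by (intro continuous_on_sum continuous_on_scaleR continuous_on_const cp[OF pl])
    have "continuous_on ?S (\<lambda>y. sweep k0 (A (?s y)) (B (?s y)) (U (?s y)) 1 (snd y))"
      using cA cB cU continuous_on_snd[OF continuous_on_id]
      by (intro continuous_on_sweep) auto
    then show ?thesis
      unfolding case_prod_beta \<Phi>_def H_def .
  qed
  have poly: "polynomial_function f"
  proof -
    define w where "w z = 1 + (\<Sum>k\<in>-{k0}. (z $ k)\<^sup>2)" for z :: "real ^ 'n"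
    define s where "s z = z $ k0 * w z" for z :: "real ^ 'n"
    have w1: "w z \<ge> 1" for z by (simp add: w_def sum_nonneg)
    have pc: "real_polynomial_function (\<lambda>z :: real ^ 'n. z $ k)" for k
      by (intro real_polynomial_function.intros(1) bounded_linear_vec_nth)
    have pw: "real_polynomial_function w"
      unfolding w_def by (intro real_polynomial_function.intros(2-4) real_polynomial_function_sum real_polynomial_function_power pc) auto
    have ps: "real_polynomial_function s"
      unfolding s_def by (intro real_polynomial_function.intros(4) pc pw)
    have pcomp: "real_polynomial_function (\<lambda>z. g (s z))" if "real_polynomial_function g" for g
      using real_polynomial_function_compose[of s g] that ps by (simp add: o_def real_polynomial_function_eq)
    have "f z = A (s z) k0
        + (\<Sum>k\<in>-{k0}. ((z $ k)\<^sup>2 * (z $ k0 * s z)) *\<^sub>R (\<Sum>j<N. W j (s z) *\<^sub>R (P j k - P j k0)))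
        + (\<Sum>k\<in>-{k0}. (z $ k)\<^sup>2 *\<^sub>R B (s z) k) + w z *\<^sub>R U (s z)" for z
    proof -
      let ?x = "\<chi> k. (z $ k)\<^sup>2"
      have w: "weight k0 ?x = w z" by (simp add: weight_f w_def)
      have "(?x $ k / w z) *\<^sub>R (A (s z) k - A (s z) k0)
          = ((z $ k)\<^sup>2 * (z $ k0 * s z)) *\<^sub>R (\<Sum>j<N. W j (s z) *\<^sub>R (P j k - P j k0))" for k
      proof -
        have "A (s z) k - A (s z) k0 = (\<Sum>j<N. L j (s z) *\<^sub>R (P j k - P j k0))"
          by (simp add: A_def scaleR_diff_right sum_subtractf)
        also have "\<dots> = (s z)\<^sup>2 *\<^sub>R (\<Sum>j<N. W j (s z) *\<^sub>R (P j k - P j k0))"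
          by (simp add: L_def scaleR_sum_right)
        finally show ?thesis
          using w1[of z] by (simp add: s_def power2_eq_square)
      qed
      then show ?thesis
        unfolding f_def H_def w using w1[of z]
        by (subst sweep_alt) (simp_all add: w s_def[symmetric])
    qed
    note f_eq = this
    note rp = real_polynomial_function.intros(2-4) real_polynomial_function_diff
      real_polynomial_function_power pcomp[OF pW] pcomp[OF pl] pcomp[OF p\<omega>] ps pw pc
    have vec: "polynomial_function (\<lambda>z. g z *\<^sub>R h z)"
      if "real_polynomial_function g" "polynomial_function h" for g and h :: "real ^ 'n \<Rightarrow> 'a"
      using that by (intro polynomial_function_mult) (simp_all add: real_polynomial_function_eq)
    have pL: "real_polynomial_function (\<lambda>z. L j (s z))" for j
      unfolding L_def by (intro rp)
    have "real_polynomial_function (\<lambda>z. \<eta> (s z))"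
      unfolding \<eta>_def by (intro rp real_polynomial_function_sum finite_lessThan pL)
    then have pA: "polynomial_function (\<lambda>z. A (s z) k)" for k
      unfolding A_def
      by (intro polynomial_function_add polynomial_function_sum vec polynomial_function_const
          finite_lessThan pL rp)
    have pB: "polynomial_function (\<lambda>z. B (s z) k)" for k
      unfolding B_def
      by (intro polynomial_function_sum vec polynomial_function_const finite_lessThan pL)
    have pU: "polynomial_function (\<lambda>z. U (s z))"
      unfolding U_def
      by (intro polynomial_function_cmul polynomial_function_sum vec polynomial_function_const
          finite_lessThan rp)
    have pQ: "polynomial_function (\<lambda>z. \<Sum>j<N. W j (s z) *\<^sub>R (P j k - P j k0))" for k
      by (intro polynomial_function_sum vec polynomial_function_const finite_lessThan rp)
    have px: "real_polynomial_function (\<lambda>z. (z $ k)\<^sup>2 * (z $ k0 * s z))"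
      "real_polynomial_function (\<lambda>z :: real ^ 'n. (z $ k)\<^sup>2)" for k by (intro rp)+
    show ?thesis
      unfolding f_eq[abs_def]
      by (intro polynomial_function_add polynomial_function_sum vec finite pA pB pU pQ px pw)
  qed
  have near: "norm (\<Phi> i \<theta> x - sweep k0 (P i) (E i) (V i) \<theta> x) \<le> \<epsilon> * (\<theta> * weight k0 x)"
    if i: "i < N" and \<theta>: "\<theta> \<in> {0..\<Theta>}" and x: "\<And>k. 0 \<le> x $ k" for i \<theta> x
  proof -
    define d where "d = sqrt \<theta> / m"
    define s where "s = real (Suc i) + d"
    have d0: "0 \<le> d" using \<theta> m0 by (simp add: d_def)
    have dr: "d \<le> r / m" unfolding d_def r_def using \<theta> m0 by (intro divide_right_mono) auto
    also have "\<dots> \<le> 1" using m1 m0 by simp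
    finally have d1: "\<bar>d\<bar> \<le> 1" using d0 by simp
    have md: "m\<^sup>2 * d\<^sup>2 = \<theta>" using \<theta> m0 by (simp add: d_def power_divide)
    let ?e = "\<lambda>j. if j = i then 1 else 0 :: real"
    have eL: "\<bar>L j s - ?e j\<bar> \<le> D * d\<^sup>2" if "j < N" for j
      using nodeW[OF i that d1] by (simp add: L_def s_def)
    have e\<omega>: "\<bar>\<omega> s\<bar> \<le> D * d\<^sup>2" using node\<omega>[OF i d1] \<omega>0 by (simp add: s_def)
    have el: "\<bar>l j s - ?e j * d\<^sup>2\<bar> \<le> D * d ^ 3" if "j < N" for j
      using nodel[OF i that d1] d0 by (cases "j = i") (simp_all add: s_def)
    have delta: "(\<Sum>j<N. ?e j *\<^sub>R Q j) = Q i" for Q :: "nat \<Rightarrow> 'a"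
      using i by (simp add: if_distrib[of "\<lambda>c. c *\<^sub>R _"] cong: if_cong)
    have comb: "norm ((\<Sum>j<N. g j *\<^sub>R Q j) - (\<Sum>j<N. h j *\<^sub>R Q j)) \<le> real N * (q * b)"
      if "\<And>j. j < N \<Longrightarrow> \<bar>g j - h j\<bar> \<le> q" "\<And>j. j < N \<Longrightarrow> norm (Q j) \<le> b" for g h q and Q :: "nat \<Rightarrow> 'a"
    proof -
      have "norm (\<Sum>j<N. (g j - h j) *\<^sub>R Q j) \<le> (\<Sum>j<N. q * b)"
        using that b0 by (intro sum_norm_le) (auto intro!: mult_mono intro: order_trans[OF abs_ge_zero])
      then show ?thesis by (simp add: scaleR_diff_left sum_subtractf)
    qed
    have e\<eta>: "\<bar>\<eta> s\<bar> \<le> (real N + 1) * (D * d\<^sup>2)"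
    proof -
      have "\<eta> s = (\<Sum>j<N. L j s - ?e j) + \<omega> s"
        using i by (simp add: \<eta>_def sum_subtractf)
      moreover have "\<bar>\<Sum>j<N. L j s - ?e j\<bar> \<le> (\<Sum>j<N. D * d\<^sup>2)"
        using eL by (intro order_trans[OF sum_abs] sum_mono) auto
      ultimately show ?thesis using e\<omega> by (simp add: algebra_simps)
    qed
    define q where "q = D * d\<^sup>2 * b"
    have q0: "q \<ge> 0" using D0 b0 by (simp add: q_def)
    have 1: "norm (A s k - P i k) \<le> (2 * real N + 2) * q" for k
    proof -
      have "norm ((\<Sum>j<N. L j s *\<^sub>R P j k) - P i k) \<le> real N * q"
        using comb[of "\<lambda>j. L j s" ?e "D * d\<^sup>2" "\<lambda>j. P j k"] eL bP delta[of "\<lambda>j. P j k"]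
        by (simp add: q_def)
      moreover have "norm (\<omega> s *\<^sub>R p) \<le> q"
        using e\<omega> bpu(1) D0 by (auto simp: q_def intro!: mult_mono)
      moreover have "norm (\<eta> s *\<^sub>R u) \<le> ((real N + 1) * (D * d\<^sup>2)) * b"
        using e\<eta> bpu(2) D0 by (auto intro!: mult_mono)
      moreover have "A s k - P i k = ((\<Sum>j<N. L j s *\<^sub>R P j k) - P i k) + \<omega> s *\<^sub>R p + \<eta> s *\<^sub>R u"
        by (simp add: A_def)
      ultimately have "norm (A s k - P i k) \<le> real N * q + q + ((real N + 1) * (D * d\<^sup>2)) * b"
        by (metis (no_types, lifting) norm_triangle_le add_mono)
      also have "\<dots> = (2 * real N + 2) * q" by (simp add: q_def algebra_simps)
      finally show ?thesis .
    qed
    have 2: "norm (B s k - E i k) \<le> real N * q" for k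
      using comb[of "\<lambda>j. L j s" ?e "D * d\<^sup>2" "\<lambda>j. E j k"] eL bE delta[of "\<lambda>j. E j k"]
      by (simp add: q_def B_def)
    have 3: "norm (U s - \<theta> *\<^sub>R V i) \<le> m\<^sup>2 * (real N * ((D * d ^ 3) * b))"
    proof -
      have "(\<Sum>j<N. (?e j * d\<^sup>2) *\<^sub>R V j) = d\<^sup>2 *\<^sub>R V i"
        using delta[of "\<lambda>j. d\<^sup>2 *\<^sub>R V j"] by simp
      then have "norm ((\<Sum>j<N. l j s *\<^sub>R V j) - d\<^sup>2 *\<^sub>R V i) \<le> real N * ((D * d ^ 3) * b)"
        using comb[of "\<lambda>j. l j s" "\<lambda>j. ?e j * d\<^sup>2" "D * d ^ 3" V] el bV by simp
      moreover have "U s - \<theta> *\<^sub>R V i = m\<^sup>2 *\<^sub>R ((\<Sum>j<N. l j s *\<^sub>R V j) - d\<^sup>2 *\<^sub>R V i)"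
        by (simp add: U_def scaleR_diff_right md)
      ultimately show ?thesis by (simp add: mult_left_mono)
    qed
    have "norm (\<Phi> i \<theta> x - sweep k0 (P i) (E i) (V i) \<theta> x)
        \<le> ((2 * real N + 2) * q + real N * q + m\<^sup>2 * (real N * ((D * d ^ 3) * b))) * weight k0 x"
      unfolding \<Phi>_def H_def sweep_diff d_def[symmetric] s_def[symmetric]
      using 1 2 3 x by (intro norm_sweep_le) simp_all
    also have "\<dots> \<le> (\<epsilon> * \<theta>) * weight k0 x"
    proof (rule mult_right_mono)
      have "d\<^sup>2 \<le> \<theta> * (1 / m)"
      proof -
        have "d\<^sup>2 = \<theta> / m\<^sup>2" using md m0 by (simp add: field_simps)
        also have "\<dots> \<le> \<theta> / m" using m0 \<theta> by (intro divide_left_mono) (auto simp: power2_eq_square)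
        finally show ?thesis by simp
      qed
      then have "(3 * real N + 2) * (D * b) * d\<^sup>2 \<le> (3 * real N + 2) * (D * b) * (\<theta> * (1 / m))"
        using D0 b0 by (intro mult_left_mono) auto
      also have "\<dots> \<le> c * (\<theta> * (1 / m))"
        unfolding c_def using D0 b0 \<theta> m0 by (intro mult_right_mono) (auto simp: algebra_simps)
      finally have q: "(2 * real N + 2) * q + real N * q \<le> c * (\<theta> * (1 / m))"
        by (simp add: q_def algebra_simps)
      have "m\<^sup>2 * d ^ 3 = \<theta> * d" unfolding md[symmetric] by (simp add: power2_eq_square power3_eq_cube)
      also have "\<dots> \<le> \<theta> * (r / m)" using dr \<theta> by (intro mult_left_mono) auto
      finally have "real N * (D * b) * (m\<^sup>2 * d ^ 3) \<le> real N * (D * b) * (\<theta> * (r / m))"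
        using D0 b0 by (intro mult_left_mono) auto
      also have "\<dots> \<le> c * (\<theta> * (r / m))"
        unfolding c_def using D0 b0 \<theta> m0 r0 by (intro mult_right_mono) (auto simp: algebra_simps)
      finally have "m\<^sup>2 * (real N * ((D * d ^ 3) * b)) \<le> c * (\<theta> * (r / m))"
        by (simp add: algebra_simps)
      then have "(2 * real N + 2) * q + real N * q + m\<^sup>2 * (real N * ((D * d ^ 3) * b))
          \<le> c * (\<theta> * (1 / m)) + c * (\<theta> * (r / m))" using q by linarith
      also have "\<dots> = (c * ((1 + r) / m)) * \<theta>" by (simp add: algebra_simps add_divide_distrib)
      also have "\<dots> \<le> \<epsilon> * \<theta>" using m_small \<theta> by (intro mult_right_mono) auto
      finally show "(2 * real N + 2) * q + real N * q + m\<^sup>2 * (real N * ((D * d ^ 3) * b)) \<le> \<epsilon> * \<theta>" .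
    qed (use weight_ge_1[of k0 x] x in auto)
    finally show ?thesis by (simp add: mult.assoc)
  qed
  show ?thesis
    by (rule that[of f \<Phi>]) (use poly HK contPhi \<Phi>_range near in \<open>auto simp: f_def\<close>)
qed

section \<open>Generators of polyhedral cones\<close>

text \<open>
  The cone is generated by its intersection with a cube, and this intersection is a polytope.
\<close>

lemma polyhedral_cone_finitely_generated:
  fixes Q :: "'a::euclidean_space set"
  assumes "polyhedron Q" and cone: "\<And>x r. \<lbrakk>x \<in> Q; 0 \<le> r\<rbrakk> \<Longrightarrow> r *\<^sub>R x \<in> Q"
  obtains G where "finite G" "G \<subseteq> Q"
    "\<And>x. x \<in> Q \<Longrightarrow> \<exists>c. (\<forall>g\<in>G. 0 \<le> c g) \<and> x = (\<Sum>g\<in>G. c g *\<^sub>R g)"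
proof -
  have "polytope (Q \<inter> cbox (-One) One)"
    using assms(1) by (simp add: polytope_eq_bounded_polyhedron polyhedron_Int bounded_Int)
  then obtain G where G: "finite G" "Q \<inter> cbox (-One) One = convex hull G"
    by (auto simp: polytope_def)
  show ?thesis
  proof (rule that[OF G(1)])
    show "G \<subseteq> Q" using G(2) hull_subset[of G convex] by auto
    fix x assume x: "x \<in> Q"
    define r where "r = 1 + norm x"
    have r: "r > 0" by (simp add: r_def add_pos_nonneg)
    have "x /\<^sub>R r \<in> cbox (-One) One"
    proof -
      have "\<bar>(x /\<^sub>R r) \<bullet> i\<bar> \<le> 1" if "i \<in> Basis" for i
        using Basis_le_norm[OF that, of x] r
        by (simp add: r_def abs_mult inverse_eq_divide divide_le_eq)
      then show ?thesis
        unfolding mem_box inner_minus_left by (fastforce simp: abs_le_iff)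
    qed
    then have "x /\<^sub>R r \<in> convex hull G" using cone[OF x, of "inverse r"] r G(2) by auto
    then obtain c where c: "\<forall>g\<in>G. 0 \<le> c g" "(\<Sum>g\<in>G. c g *\<^sub>R g) = x /\<^sub>R r"
      unfolding convex_hull_finite[OF G(1)] by blast
    have "x = r *\<^sub>R (\<Sum>g\<in>G. c g *\<^sub>R g)" using c(2) r by simp
    also have "\<dots> = (\<Sum>g\<in>G. (r * c g) *\<^sub>R g)" by (simp add: scaleR_sum_right)
    finally show "\<exists>c. (\<forall>g\<in>G. 0 \<le> c g) \<and> x = (\<Sum>g\<in>G. c g *\<^sub>R g)"
      using c(1) r by (intro exI[of _ "\<lambda>g. r * c g"]) auto
  qed
qed

text \<open>
  A representation with the fewest generators is independent, even together with
  \<open>\<nu>\<close>: a linear relation could be subtracted from the representation until a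
  coefficient vanishes, in a direction that does not decrease the coefficient of
  \<open>\<nu>\<close>. The only obstruction would be a relation that expresses \<open>-
  \<nu>\<close> as a nonnegative combination, which the hypothesis excludes.
\<close>

lemma conic_exchange:
  fixes G :: "'a::euclidean_space set"
  assumes G: "finite G"
    and pointed: "\<And>c. \<forall>g\<in>G. 0 \<le> c g \<Longrightarrow> (\<Sum>g\<in>G. c g *\<^sub>R g) \<noteq> - \<nu>"
    and c: "\<forall>g\<in>G. 0 \<le> c g" and w: "w = (\<Sum>g\<in>G. c g *\<^sub>R g)"
  obtains B c' \<tau> where "B \<subseteq> G - {\<nu>}" "independent (insert \<nu> B)" "\<forall>b\<in>B. 0 \<le> c' b" "0 \<le> \<tau>"
    "w = (\<Sum>b\<in>B. c' b *\<^sub>R b) + \<tau> *\<^sub>R \<nu>"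
proof -
  define Rep where "Rep B \<longleftrightarrow> B \<subseteq> G - {\<nu>} \<and>
    (\<exists>c' \<tau>. (\<forall>b\<in>B. 0 \<le> c' b) \<and> 0 \<le> \<tau> \<and> w = (\<Sum>b\<in>B. c' b *\<^sub>R b) + \<tau> *\<^sub>R \<nu>)" for B
  have "Rep (G - {\<nu>})"
  proof (cases "\<nu> \<in> G")
    case True
    then have "w = (\<Sum>b\<in>G - {\<nu>}. c b *\<^sub>R b) + c \<nu> *\<^sub>R \<nu>"
      using G w by (simp add: sum.remove add.commute)
    then show ?thesis unfolding Rep_def using c True by blast
  next
    case False
    then have "w = (\<Sum>b\<in>G - {\<nu>}. c b *\<^sub>R b) + 0 *\<^sub>R \<nu>" using w by simp
    then show ?thesis unfolding Rep_def using c by blast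
  qed
  then obtain B where B: "Rep B" and least: "\<And>B'. Rep B' \<Longrightarrow> card B \<le> card B'"
    using ex_has_least_nat[of Rep _ card] by blast
  obtain c' \<tau> where c': "B \<subseteq> G - {\<nu>}" "\<forall>b\<in>B. 0 \<le> c' b" "0 \<le> \<tau>"
      "w = (\<Sum>b\<in>B. c' b *\<^sub>R b) + \<tau> *\<^sub>R \<nu>"
    using B unfolding Rep_def by blast
  have finB: "finite B" using c'(1) G finite_subset by blast
  have \<nu>B: "\<nu> \<notin> B" using c'(1) by blast
  (* Subtract \<open>t\<close> times the relation, with the largest \<open>t\<close> that keeps all coefficients nonnegative. *)
  have no_reduction: False
    if e: "(\<Sum>b\<in>B. e b *\<^sub>R b) = \<eta> *\<^sub>R \<nu>" "\<eta> \<ge> 0" "\<exists>b\<in>B. e b > 0" for e \<eta>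
  proof -
    define R where "R = {b \<in> B. e b > 0}"
    define t where "t = Min ((\<lambda>b. c' b / e b) ` R)"
    have R: "finite R" "R \<noteq> {}" using finB e(3) by (auto simp: R_def)
    then have "t \<in> (\<lambda>b. c' b / e b) ` R" unfolding t_def by (intro Min_in) auto
    then obtain b0 where b0: "b0 \<in> B" "e b0 > 0" "t = c' b0 / e b0" by (auto simp: R_def)
    have t0: "t \<ge> 0" using b0 c'(2) by simp
    have nonneg: "0 \<le> c' b - t * e b" if "b \<in> B" for b
    proof (cases "e b > 0")
      case True
      then have "t \<le> c' b / e b" unfolding t_def using R that by (intro Min_le) (auto simp: R_def)
      then show ?thesis using True by (simp add: field_simps)
    next
      case False
      then have "t * e b \<le> 0" using t0 by (simp add: mult_nonneg_nonpos)
      moreover have "0 \<le> c' b" using c'(2) that by blast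
      ultimately show ?thesis by linarith
    qed
    have "(\<Sum>b\<in>B. (c' b - t * e b) *\<^sub>R b) = (\<Sum>b\<in>B. c' b *\<^sub>R b) - t *\<^sub>R (\<Sum>b\<in>B. e b *\<^sub>R b)"
      by (simp add: scaleR_diff_left sum_subtractf scaleR_sum_right)
    then have "w = (\<Sum>b\<in>B. (c' b - t * e b) *\<^sub>R b) + (\<tau> + t * \<eta>) *\<^sub>R \<nu>"
      using c'(4) e(1) by (simp add: algebra_simps)
    moreover have "c' b0 - t * e b0 = 0" using b0 by simp
    ultimately have "w = (\<Sum>b\<in>B - {b0}. (c' b - t * e b) *\<^sub>R b) + (\<tau> + t * \<eta>) *\<^sub>R \<nu>"
      using sum.remove[OF finB b0(1), of "\<lambda>b. (c' b - t * e b) *\<^sub>R b"] by simp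
    moreover have "0 \<le> \<tau> + t * \<eta>" using c'(3) t0 e(2) by simp
    ultimately have "Rep (B - {b0})" unfolding Rep_def using c'(1) nonneg
      by (intro conjI exI[of _ "\<lambda>b. c' b - t * e b"] exI[of _ "\<tau> + t * \<eta>"]) auto
    then have "card B \<le> card (B - {b0})" by (rule least)
    then show False using card_Diff1_less[OF finB b0(1)] by simp
  qed
  have "independent (insert \<nu> B)"
    unfolding independent_explicit
  proof (intro conjI allI impI ballI)
    show "finite (insert \<nu> B)" using finB by simp
    fix d v assume d: "(\<Sum>v\<in>insert \<nu> B. d v *\<^sub>R v) = 0" and v: "v \<in> insert \<nu> B"
    then have d': "(\<Sum>b\<in>B. d b *\<^sub>R b) = (- d \<nu>) *\<^sub>R \<nu>"
      using finB \<nu>B by (simp add: eq_neg_iff_add_eq_0 add.commute)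
    have d\<nu>: "d \<nu> = 0"
    proof (rule ccontr)
      assume nz: "d \<nu> \<noteq> 0"
      define e where "e b = - d b / d \<nu>" for b
      have "(\<Sum>b\<in>B. e b *\<^sub>R b) = (- 1 / d \<nu>) *\<^sub>R (\<Sum>b\<in>B. d b *\<^sub>R b)"
        by (simp add: e_def scaleR_sum_right)
      also have "\<dots> = \<nu>" using d' nz by simp
      finally have e: "(\<Sum>b\<in>B. e b *\<^sub>R b) = 1 *\<^sub>R \<nu>" by simp
      show False
      proof (cases "\<exists>b\<in>B. e b > 0")
        case True then show False using no_reduction[OF e] by simp
      next
        case False
        define g where "g b = (if b \<in> B then - e b else 0)" for b
        have "(\<Sum>b\<in>G. g b *\<^sub>R b) = (\<Sum>b\<in>B. - e b *\<^sub>R b)"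
          using G c'(1) by (intro sum.mono_neutral_cong_right) (auto simp: g_def)
        also have "\<dots> = - \<nu>" using e by (simp add: sum_negf)
        finally have "(\<Sum>b\<in>G. g b *\<^sub>R b) = - \<nu>" .
        moreover have "\<forall>b\<in>G. 0 \<le> g b" using False by (auto simp: g_def not_less)
        ultimately show False using pointed by blast
      qed
    qed
    have "d b = 0" if b: "b \<in> B" for b
    proof (rule ccontr)
      assume "d b \<noteq> 0"
      then consider "d b > 0" | "- d b > 0" by linarith
      then show False
      proof cases
        case 1 then show False using no_reduction[of d 0] d' d\<nu> b by auto
      next
        case 2
        moreover have "(\<Sum>b\<in>B. (- d b) *\<^sub>R b) = 0 *\<^sub>R \<nu>" using d' d\<nu> by (simp add: sum_negf)
        ultimately show False using no_reduction[of "\<lambda>b. - d b" 0] b by auto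
      qed
    qed
    then show "d v = 0" using d\<nu> v by blast
  qed
  then show ?thesis using that c' by blast
qed

lemma conic_basis_with_axis:
  fixes G :: "'a::euclidean_space set"
  assumes G: "finite G" and span: "span G = UNIV"
    and pointed: "\<And>c. \<forall>g\<in>G. 0 \<le> c g \<Longrightarrow> (\<Sum>g\<in>G. c g *\<^sub>R g) \<noteq> - \<nu>"
    and c: "\<forall>g\<in>G. 0 \<le> c g" and w: "w = (\<Sum>g\<in>G. c g *\<^sub>R g)"
  obtains B c' where "\<nu> \<in> B" "B \<subseteq> insert \<nu> G" "independent B" "card B = DIM('a)"
    "\<forall>b\<in>B. 0 \<le> c' b" "w = (\<Sum>b\<in>B. c' b *\<^sub>R b)"
proof -
  obtain B0 d \<tau> where B0: "B0 \<subseteq> G - {\<nu>}" "independent (insert \<nu> B0)" "\<forall>b\<in>B0. 0 \<le> d b" "0 \<le> \<tau>"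
    "w = (\<Sum>b\<in>B0. d b *\<^sub>R b) + \<tau> *\<^sub>R \<nu>"
    using conic_exchange[OF G pointed c w] by blast
  obtain B where B: "insert \<nu> B0 \<subseteq> B" "B \<subseteq> insert \<nu> G" "independent B" "insert \<nu> G \<subseteq> span B"
    using maximal_independent_subset_extend[of "insert \<nu> B0" "insert \<nu> G"] B0(1,2) by blast
  have "span B = UNIV"
    using span B(4) span_minimal[of G "span B"] by (auto simp: subspace_span)
  then have card: "card B = DIM('a)" using dim_span_eq_card_independent[OF B(3)] by (simp add: dim_UNIV)
  have finB: "finite B" using B(2) G finite_subset by blast
  define c' where "c' b = (if b = \<nu> then \<tau> else if b \<in> B0 then d b else 0)" for b
  have "(\<Sum>b\<in>B. c' b *\<^sub>R b) = (\<Sum>b\<in>insert \<nu> B0. c' b *\<^sub>R b)"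
    using B(1) finB by (intro sum.mono_neutral_right) (auto simp: c'_def)
  also have "\<dots> = \<tau> *\<^sub>R \<nu> + (\<Sum>b\<in>B0. c' b *\<^sub>R b)"
    using B0(1) finite_subset[OF _ finB, of B0] B(1) by (subst sum.insert) (auto simp: c'_def)
  also have "(\<Sum>b\<in>B0. c' b *\<^sub>R b) = (\<Sum>b\<in>B0. d b *\<^sub>R b)"
    using B0(1) by (intro sum.cong) (auto simp: c'_def)
  finally have "w = (\<Sum>b\<in>B. c' b *\<^sub>R b)" using B0(5) by simp
  moreover have "\<forall>b\<in>B. 0 \<le> c' b" using B0(3,4) by (simp add: c'_def)
  ultimately show ?thesis using that B card by blast
qed

lemma enumerate_with_first:
  fixes k0 :: "'n::finite"
  assumes "finite B" "card B = CARD('n)" "m \<in> B"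
  obtains h :: "'n \<Rightarrow> 'b" where "bij_betw h UNIV B" "h k0 = m"
proof -
  have "card (UNIV - {k0}) = card (B - {m})" using assms by simp
  then obtain f where f: "bij_betw f (UNIV - {k0}) (B - {m})"
    using finite_same_card_bij[of "UNIV - {k0}" "B - {m}"] assms(1) by auto
  have img: "f ` (UNIV - {k0}) = B - {m}" and inj: "inj_on f (UNIV - {k0})"
    using f by (auto simp: bij_betw_def)
  have "range (f(k0 := m)) = insert m (f ` (UNIV - {k0}))" by auto
  then have "range (f(k0 := m)) = B" using img assms(3) by auto
  moreover have "inj (f(k0 := m))"
    using inj img by (auto simp: inj_on_def)
  ultimately show ?thesis by (intro that[of "f(k0 := m)"]) (auto simp: bij_betw_def)
qed

section \<open>The homogenization of a polyhedron\<close>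

lemma convex_with_recession_cone:
  assumes "convex K"
  shows "convex_with_recession K (recession_cone K)"
proof
  show "convex K" by fact
next
  fix x y assume xy: "x \<in> recession_cone K" "y \<in> recession_cone K"
  show "x + y \<in> recession_cone K"
    unfolding recession_cone_def
  proof (intro CollectI ballI allI impI)
    fix p and l :: real assume p: "p \<in> K" "0 \<le> l"
    have "(p + l *\<^sub>R x) + l *\<^sub>R y \<in> K" using xy p by (auto simp: recession_cone_def)
    then show "p + l *\<^sub>R (x + y) \<in> K" by (simp add: scaleR_add_right add.assoc)
  qed
next
  fix x and r :: real assume "x \<in> recession_cone K" "0 \<le> r"
  then show "r *\<^sub>R x \<in> recession_cone K" by (auto simp: recession_cone_def)
next
  show "0 \<in> recession_cone K" by (simp add: recession_cone_def)
next
  fix p x assume "p \<in> K" "x \<in> recession_cone K"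
  then have "\<forall>l\<ge>0. p + l *\<^sub>R x \<in> K" by (simp add: recession_cone_def)
  then have "p + 1 *\<^sub>R x \<in> K" using zero_le_one by blast
  then show "p + x \<in> K" by simp
qed

text \<open>
  The cone over \<open>K \<times> {1}\<close>, closed up by the recession directions at level 0,
  is polyhedral. Its generators are normalized to level 1 or level 0, so they are points of
  \<open>K\<close> and recession directions, and together they represent all of \<open>K\<close>.
\<close>

lemma homogeneous_generators:
  fixes K :: "'a::euclidean_space set"
  assumes "polyhedron K" "K \<noteq> {}"
  obtains \<Gamma> :: "('a \<times> real) set" where "finite \<Gamma>"
    "\<And>\<gamma>. \<gamma> \<in> \<Gamma> \<Longrightarrow> (snd \<gamma> = 1 \<and> fst \<gamma> \<in> K) \<or> (snd \<gamma> = 0 \<and> fst \<gamma> \<in> recession_cone K)"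
    "\<And>q. q \<in> K \<Longrightarrow> \<exists>c. (\<forall>\<gamma>\<in>\<Gamma>. 0 \<le> c \<gamma>) \<and> (q, 1) = (\<Sum>\<gamma>\<in>\<Gamma>. c \<gamma> *\<^sub>R \<gamma>)"
    "\<And>y. y \<in> recession_cone K \<Longrightarrow> \<exists>c. (\<forall>\<gamma>\<in>\<Gamma>. 0 \<le> c \<gamma>) \<and> (y, 0) = (\<Sum>\<gamma>\<in>\<Gamma>. c \<gamma> *\<^sub>R \<gamma>)"
proof -
  obtain F where F: "finite F" "K = \<Inter>F" "\<forall>h\<in>F. \<exists>a b. a \<noteq> 0 \<and> h = {x. a \<bullet> x \<le> b}"
    using assms(1) unfolding polyhedron_def by blast
  then obtain a b where ab: "\<And>h. h \<in> F \<Longrightarrow> h = {x. a h \<bullet> x \<le> b h}"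
    by metis
  have K: "x \<in> K \<longleftrightarrow> (\<forall>h\<in>F. a h \<bullet> x \<le> b h)" for x
    using F(2) ab by blast
  define Q where "Q = {z. \<forall>h\<in>F. (a h, - b h) \<bullet> z \<le> 0} \<inter> {z. (0, - 1) \<bullet> z \<le> 0}"
  have Q: "z \<in> Q \<longleftrightarrow> 0 \<le> snd z \<and> (\<forall>h\<in>F. a h \<bullet> fst z \<le> b h * snd z)" for z
    by (cases z) (auto simp: Q_def)
  have "{z. \<forall>h\<in>F. (a h, - b h) \<bullet> z \<le> 0} = \<Inter>((\<lambda>h. {z. (a h, - b h) \<bullet> z \<le> 0}) ` F)" by auto
  then have "polyhedron {z. \<forall>h\<in>F. (a h, - b h) \<bullet> z \<le> 0}"
    using F(1) by (auto intro!: polyhedron_Inter polyhedron_halfspace_le)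
  then have polyQ: "polyhedron Q" unfolding Q_def
    by (intro polyhedron_Int polyhedron_halfspace_le)
  have coneQ: "r *\<^sub>R z \<in> Q" if "z \<in> Q" "0 \<le> r" for z r
    using that mult_left_mono[of _ _ r] unfolding Q
    by (auto simp: mult.left_commute)
  obtain G where G: "finite G" "G \<subseteq> Q"
    "\<And>x. x \<in> Q \<Longrightarrow> \<exists>c. (\<forall>g\<in>G. 0 \<le> c g) \<and> x = (\<Sum>g\<in>G. c g *\<^sub>R g)"
    by (rule polyhedral_cone_finitely_generated[OF polyQ coneQ]) blast+
  define sc where "sc g = (if snd g = 0 then 1 else snd g)" for g :: "'a \<times> real"
  define N where "N g = g /\<^sub>R sc g" for g
  have sc: "sc g > 0" if "g \<in> G" for g using that G(2) Q[of g] by (auto simp: sc_def)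
  have gN: "g = sc g *\<^sub>R N g" if "g \<in> G" for g using sc[OF that] by (simp add: N_def)
  have rep: "\<exists>c. (\<forall>\<gamma>\<in>N ` G. 0 \<le> c \<gamma>) \<and> x = (\<Sum>\<gamma>\<in>N ` G. c \<gamma> *\<^sub>R \<gamma>)" if x: "x \<in> Q" for x
  proof -
    obtain c where c: "\<forall>g\<in>G. 0 \<le> c g" "x = (\<Sum>g\<in>G. c g *\<^sub>R g)" using G(3)[OF x] by blast
    (* Normalization may identify several generators, whose coefficients are then added. *)
    define c' where "c' \<gamma> = (\<Sum>g | g \<in> G \<and> N g = \<gamma>. c g * sc g)" for \<gamma>
    have "x = (\<Sum>g\<in>G. (c g * sc g) *\<^sub>R N g)"
      unfolding c(2) by (intro sum.cong refl) (metis gN scaleR_scaleR)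
    also have "\<dots> = (\<Sum>\<gamma>\<in>N ` G. \<Sum>g | g \<in> G \<and> N g = \<gamma>. (c g * sc g) *\<^sub>R N g)"
      by (rule sum.image_gen[OF G(1)])
    also have "\<dots> = (\<Sum>\<gamma>\<in>N ` G. c' \<gamma> *\<^sub>R \<gamma>)"
      by (intro sum.cong refl) (simp add: c'_def scaleR_sum_left)
    finally have "x = (\<Sum>\<gamma>\<in>N ` G. c' \<gamma> *\<^sub>R \<gamma>)" .
    moreover have "0 \<le> c' \<gamma>" for \<gamma>
      unfolding c'_def using c(1) sc by (intro sum_nonneg) (simp add: less_imp_le)
    ultimately show ?thesis by (intro exI[of _ c'] conjI ballI)
  qed
  show ?thesis
  proof (rule that[of "N ` G"])
    show "finite (N ` G)" using G(1) by simp
    fix \<gamma> assume "\<gamma> \<in> N ` G"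
    then obtain g where g: "g \<in> G" "\<gamma> = N g" by blast
    then have \<gamma>Q: "\<gamma> \<in> Q" using coneQ[of g "inverse (sc g)"] G(2) sc[of g] by (auto simp: N_def)
    show "(snd \<gamma> = 1 \<and> fst \<gamma> \<in> K) \<or> (snd \<gamma> = 0 \<and> fst \<gamma> \<in> recession_cone K)"
    proof (cases "snd g = 0")
      case True
      then have s0: "snd \<gamma> = 0" by (simp add: g N_def)
      then have "a h \<bullet> fst \<gamma> \<le> 0" if "h \<in> F" for h using \<gamma>Q that by (auto simp: Q)
      then have "a h \<bullet> (p + l *\<^sub>R fst \<gamma>) \<le> b h" if "h \<in> F" "p \<in> K" "0 \<le> l" for h p l
        using that K[of p] mult_nonneg_nonpos[of l "a h \<bullet> fst \<gamma>"] by (fastforce simp: inner_add_right)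
      then show ?thesis using s0 by (auto simp: recession_cone_def K)
    next
      case False
      then have "snd \<gamma> = 1" by (simp add: g N_def sc_def)
      then show ?thesis using \<gamma>Q by (simp add: Q K)
    qed
  next
    fix q assume "q \<in> K"
    then have "(q, 1) \<in> Q" by (simp add: Q K)
    then show "\<exists>c. (\<forall>\<gamma>\<in>N ` G. 0 \<le> c \<gamma>) \<and> (q, 1) = (\<Sum>\<gamma>\<in>N ` G. c \<gamma> *\<^sub>R \<gamma>)" by (rule rep)
  next
    fix y assume y: "y \<in> recession_cone K"
    obtain p where p: "p \<in> K" using assms(2) by blast
    have "a h \<bullet> y \<le> 0" if h: "h \<in> F" for h
    proof (rule ccontr)
      assume "\<not> a h \<bullet> y \<le> 0"
      then have pos: "a h \<bullet> y > 0" by simp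
      define l where "l = (b h - a h \<bullet> p + 1) / (a h \<bullet> y)"
      have "a h \<bullet> p \<le> b h" using p h K by blast
      then have "0 \<le> l" using pos by (simp add: l_def)
      then have "p + l *\<^sub>R y \<in> K" using y p by (auto simp: recession_cone_def)
      then have "a h \<bullet> (p + l *\<^sub>R y) \<le> b h" using h K by blast
      then show False using pos by (simp add: l_def inner_add_right)
    qed
    then have "(y, 0) \<in> Q" by (simp add: Q)
    then show "\<exists>c. (\<forall>\<gamma>\<in>N ` G. 0 \<le> c \<gamma>) \<and> (y, 0) = (\<Sum>\<gamma>\<in>N ` G. c \<gamma> *\<^sub>R \<gamma>)" by (rule rep)
  qed
qed

text \<open>
  The setting of the covering argument: \<open>v\<close> is an interior vector of
  \<open>C\<close>, and \<open>\<Gamma>\<close> generates both \<open>K\<close> at level 1 and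
  \<open>C\<close> at level 0. The condition on \<open>- v\<close> says that \<open>C\<close> is
  not the whole space.
\<close>

locale generated_polyhedron = convex_with_recession K C
  for K C :: "(real ^ 'n::finite) set" +
  fixes v :: "real ^ 'n" and \<rho> :: real and \<Gamma> :: "((real ^ 'n) \<times> real) set" and p0 :: "real ^ 'n"
  assumes \<rho>: "0 < \<rho>" and near_axis: "\<And>x. norm x \<le> \<rho> \<Longrightarrow> v + x \<in> C"
    and axis_pointed: "- v \<notin> C"
    and finite_gen: "finite \<Gamma>"
    and gen: "\<And>\<gamma>. \<gamma> \<in> \<Gamma> \<Longrightarrow> (snd \<gamma> = 1 \<and> fst \<gamma> \<in> K) \<or> (snd \<gamma> = 0 \<and> fst \<gamma> \<in> C)"
    and K_gen: "\<And>q. q \<in> K \<Longrightarrow> \<exists>c. (\<forall>\<gamma>\<in>\<Gamma>. 0 \<le> c \<gamma>) \<and> (q, 1) = (\<Sum>\<gamma>\<in>\<Gamma>. c \<gamma> *\<^sub>R \<gamma>)"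
    and C_gen: "\<And>y. y \<in> C \<Longrightarrow> \<exists>c. (\<forall>\<gamma>\<in>\<Gamma>. 0 \<le> c \<gamma>) \<and> (y, 0) = (\<Sum>\<gamma>\<in>\<Gamma>. c \<gamma> *\<^sub>R \<gamma>)"
    and p0: "p0 \<in> K"
begin

lemma near_axis_scaled:
  assumes "norm x \<le> r * \<rho>" "0 < r"
  shows "r *\<^sub>R v + x \<in> C"
proof -
  have "norm (x /\<^sub>R r) \<le> \<rho>" using assms by (simp add: inverse_eq_divide divide_le_eq mult.commute)
  then have "r *\<^sub>R (v + x /\<^sub>R r) \<in> C" using assms by (intro cone_scale near_axis) auto
  then show ?thesis using assms by (simp add: scaleR_add_right)
qed

lemma axis_in_C: "v \<in> C"
  using near_axis[of 0] \<rho> by simp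

lemma span_eq_UNIV_if_contains_C:
  assumes "C \<subseteq> span S"
  shows "span S = UNIV"
proof -
  have "x \<in> span S" for x
  proof -
    define r where "r = norm x / \<rho> + 1"
    have r: "0 < r" "norm x \<le> r * \<rho>"
      using \<rho> by (simp_all add: r_def add_nonneg_pos distrib_right)
    have "r *\<^sub>R v + x \<in> span S" "r *\<^sub>R v \<in> span S"
      using near_axis_scaled[OF r(2,1)] axis_in_C r(1) assms by (auto intro: span_scale)
    then have "(r *\<^sub>R v + x) - r *\<^sub>R v \<in> span S" by (rule span_diff)
    then show ?thesis by simp
  qed
  then show ?thesis by blast
qed

lemma level_zero_representation:
  assumes c: "\<forall>\<gamma>\<in>\<Gamma>. 0 \<le> c \<gamma>" and y: "(y, 0) = (\<Sum>\<gamma>\<in>\<Gamma>. c \<gamma> *\<^sub>R \<gamma>)"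
  shows "y = (\<Sum>\<gamma>\<in>{\<gamma> \<in> \<Gamma>. snd \<gamma> = 0}. c \<gamma> *\<^sub>R fst \<gamma>)"
proof -
  have "(\<Sum>\<gamma>\<in>\<Gamma>. c \<gamma> * snd \<gamma>) = 0" using arg_cong[OF y, of snd] by (simp add: snd_sum)
  then have zero: "c \<gamma> = 0" if "\<gamma> \<in> \<Gamma>" "snd \<gamma> \<noteq> 0" for \<gamma>
    using sum_nonneg_eq_0_iff[OF finite_gen, of "\<lambda>\<gamma>. c \<gamma> * snd \<gamma>"] c gen that by fastforce
  have "y = (\<Sum>\<gamma>\<in>\<Gamma>. c \<gamma> *\<^sub>R fst \<gamma>)" using arg_cong[OF y, of fst] by (simp add: fst_sum)
  also have "\<dots> = (\<Sum>\<gamma>\<in>{\<gamma> \<in> \<Gamma>. snd \<gamma> = 0}. c \<gamma> *\<^sub>R fst \<gamma>)"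
    using zero finite_gen by (intro sum.mono_neutral_right) auto
  finally show ?thesis .
qed

lemma no_opposite_axis:
  assumes c: "\<forall>\<gamma>\<in>\<Gamma>. 0 \<le> c \<gamma>"
  shows "(\<Sum>\<gamma>\<in>\<Gamma>. c \<gamma> *\<^sub>R \<gamma>) \<noteq> - (v, 0)"
proof
  assume "(\<Sum>\<gamma>\<in>\<Gamma>. c \<gamma> *\<^sub>R \<gamma>) = - (v, 0)"
  then have "(- v, 0) = (\<Sum>\<gamma>\<in>\<Gamma>. c \<gamma> *\<^sub>R \<gamma>)" by simp
  then have "- v = (\<Sum>\<gamma>\<in>{\<gamma> \<in> \<Gamma>. snd \<gamma> = 0}. c \<gamma> *\<^sub>R fst \<gamma>)" by (rule level_zero_representation[OF c])
  also have "\<dots> \<in> C" using c gen by (intro cone_sum) fastforce+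
  finally show False using axis_pointed by simp
qed

lemma span_gen: "span \<Gamma> = UNIV"
proof -
  have sum_in: "(\<Sum>\<gamma>\<in>\<Gamma>. c \<gamma> *\<^sub>R \<gamma>) \<in> span \<Gamma>" for c
    by (intro span_sum span_scale span_base)
  have C: "(y, 0) \<in> span \<Gamma>" if "y \<in> C" for y using C_gen[OF that] sum_in by metis
  have flat: "(x, 0) \<in> span \<Gamma>" for x
  proof -
    define r where "r = norm x / \<rho> + 1"
    have r: "0 < r" "norm x \<le> r * \<rho>"
      using \<rho> by (simp_all add: r_def add_nonneg_pos distrib_right)
    have "(r *\<^sub>R v + x, 0) - r *\<^sub>R (v, 0) \<in> span \<Gamma>"
      using near_axis_scaled[OF r(2,1)] axis_in_C C by (intro span_diff span_scale) auto
    then show ?thesis by simp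
  qed
  have p: "(p0, 1) \<in> span \<Gamma>" using K_gen[OF p0] sum_in by metis
  have "(x, t) \<in> span \<Gamma>" for x t
  proof -
    have "t *\<^sub>R (p0, 1) + (x - t *\<^sub>R p0, 0) \<in> span \<Gamma>" using p flat by (intro span_add span_scale)
    then show ?thesis by simp
  qed
  then show ?thesis by auto
qed

text \<open>
  Each point of \<open>K\<close> lies above a simplicial piece with \<open>CARD('n)\<close>
  generators, at a height \<open>\<tau>\<close> in the direction \<open>v\<close>. The generator
  of index \<open>k0\<close> is a point whose barycentric coordinate is at least \<open>1 /
  CARD('n)\<close>; there is one because these coordinates have sum 1.
\<close>

lemma axis_representation:
  fixes k0 :: 'n
  assumes "q \<in> K"
  obtains h c \<tau> where "\<And>k. h k \<in> \<Gamma>" "snd (h k0) = 1" "\<And>k. 0 \<le> c k" "0 \<le> \<tau>"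
    "1 / real CARD('n) \<le> c k0" "(\<Sum>k\<in>UNIV. c k * snd (h k)) = 1"
    "q = (\<Sum>k\<in>UNIV. c k *\<^sub>R fst (h k)) + \<tau> *\<^sub>R v"
    "\<And>z t. (\<Sum>k\<in>UNIV. z k *\<^sub>R h k) + t *\<^sub>R (v, 0) = 0 \<Longrightarrow> (\<forall>k::'n. z k = 0) \<and> t = 0"
proof -
  define \<nu> :: "(real ^ 'n) \<times> real" where "\<nu> = (v, 0)"
  obtain c0 where "\<forall>\<gamma>\<in>\<Gamma>. 0 \<le> c0 \<gamma>" "(q, 1) = (\<Sum>\<gamma>\<in>\<Gamma>. c0 \<gamma> *\<^sub>R \<gamma>)"
    using K_gen[OF assms] by blast
  then obtain B c' where B: "\<nu> \<in> B" "B \<subseteq> insert \<nu> \<Gamma>" "independent B"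
      "card B = DIM((real ^ 'n) \<times> real)" "\<forall>b\<in>B. 0 \<le> c' b" "(q, 1) = (\<Sum>b\<in>B. c' b *\<^sub>R b)"
    using conic_basis_with_axis[OF finite_gen span_gen no_opposite_axis[folded \<nu>_def]] by blast
  have finB: "finite B" using B(2) finite_gen finite_subset by blast
  define B' where "B' = B - {\<nu>}"
  have B': "finite B'" "card B' = CARD('n)" "B' \<subseteq> \<Gamma>" using B finB by (auto simp: B'_def)
  have q: "(q, 1) = (\<Sum>b\<in>B'. c' b *\<^sub>R b) + c' \<nu> *\<^sub>R \<nu>"
    using sum.remove[OF finB B(1), of "\<lambda>b. c' b *\<^sub>R b"] B(6) by (simp add: B'_def add.commute)
  have q1: "(\<Sum>b\<in>B'. c' b * snd b) = 1"
    using arg_cong[OF q, of snd] by (simp add: snd_sum \<nu>_def)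
  have q2: "q = (\<Sum>b\<in>B'. c' b *\<^sub>R fst b) + c' \<nu> *\<^sub>R v"
    using arg_cong[OF q, of fst] by (simp add: fst_sum \<nu>_def)
  have "\<exists>m\<in>B'. snd m = 1 \<and> 1 / real CARD('n) \<le> c' m"
  proof (rule ccontr)
    assume none: "\<not> (\<exists>m\<in>B'. snd m = 1 \<and> 1 / real CARD('n) \<le> c' m)"
    have "c' b * snd b < 1 / real CARD('n)" if "b \<in> B'" for b
    proof (cases "snd b = 0")
      case False
      then have "snd b = 1" using gen[of b] B'(3) \<open>b \<in> B'\<close> by auto
      moreover from this have "c' b < 1 / real CARD('n)"
        using none \<open>b \<in> B'\<close> by (meson not_le)
      ultimately show ?thesis by simp
    qed simp
    then have "(\<Sum>b\<in>B'. c' b * snd b) < (\<Sum>b\<in>B'. 1 / real CARD('n))"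
      using B'(1,2) by (intro sum_strict_mono) auto
    also have "\<dots> = 1" using B'(2) by simp
    finally show False using q1 by simp
  qed
  then obtain m where m: "m \<in> B'" "snd m = 1" "1 / real CARD('n) \<le> c' m" by blast
  obtain h :: "'n \<Rightarrow> _" where h: "bij_betw h UNIV B'" "h k0 = m"
    using enumerate_with_first[OF B'(1,2) m(1)] by blast
  have hB: "h k \<in> B'" for k using h(1) by (auto simp: bij_betw_def)
  have reindex: "(\<Sum>k\<in>UNIV. f (h k)) = (\<Sum>b\<in>B'. f b)" for f :: "_ \<Rightarrow> 'c::comm_monoid_add"
    using sum.reindex_bij_betw[OF h(1)] by blast
  have inj: "inj h" using h(1) by (simp add: bij_betw_def)
  show ?thesis
  proof (rule that[of h "\<lambda>k. c' (h k)" "c' \<nu>"])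
    show "h k \<in> \<Gamma>" for k using hB B'(3) by blast
    show "0 \<le> c' (h k)" for k using hB B(5) by (auto simp: B'_def)
    show "(\<Sum>k\<in>UNIV. c' (h k) * snd (h k)) = 1" using reindex[of "\<lambda>b. c' b * snd b"] q1 by simp
    show "q = (\<Sum>k\<in>UNIV. c' (h k) *\<^sub>R fst (h k)) + c' \<nu> *\<^sub>R v"
      using reindex[of "\<lambda>b. c' b *\<^sub>R fst b"] q2 by simp
    fix z t assume zt: "(\<Sum>k\<in>UNIV. z k *\<^sub>R h k) + t *\<^sub>R (v, 0) = 0"
    define d where "d b = (if b = \<nu> then t else z (inv h b))" for b
    have dh: "d (h k) = z k" for k using hB[of k] inj by (auto simp: d_def B'_def)
    have "(\<Sum>b\<in>B. d b *\<^sub>R b) = d \<nu> *\<^sub>R \<nu> + (\<Sum>b\<in>B'. d b *\<^sub>R b)"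
      unfolding B'_def by (rule sum.remove[OF finB B(1)])
    also have "(\<Sum>b\<in>B'. d b *\<^sub>R b) = (\<Sum>k\<in>UNIV. z k *\<^sub>R h k)"
      using reindex[of "\<lambda>b. d b *\<^sub>R b"] by (simp add: dh)
    finally have "(\<Sum>b\<in>B. d b *\<^sub>R b) = 0" using zt by (simp add: d_def \<nu>_def add.commute)
    then have "\<forall>b\<in>B. d b = 0" using B(3) by (simp add: independent_explicit)
    then show "(\<forall>k. z k = 0) \<and> t = 0" using dh hB B(1) by (metis B'_def DiffD1 d_def)
  qed (use m h B(1,5) in auto)
qed

text \<open>
  For points of \<open>C\<close> the vector \<open>v\<close> counts as one more generator. The
  smallest coefficient is put at the index \<open>k0\<close>, because its generator will be the
  axis of a sweep.
\<close>

lemma cone_representation: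
  fixes k0 :: 'n
  assumes "y \<in> C"
  obtains h c where "\<And>k. h k \<in> insert v (fst ` {\<gamma> \<in> \<Gamma>. snd \<gamma> = 0})" "\<And>k. 0 \<le> c k"
    "\<And>k. c k0 \<le> c k" "y = (\<Sum>k\<in>UNIV. c k *\<^sub>R h k)"
    "\<And>z. (\<Sum>k\<in>UNIV. z k *\<^sub>R h k) = 0 \<Longrightarrow> (\<forall>k::'n. z k = 0)"
proof -
  define G where "G = {\<gamma> \<in> \<Gamma>. snd \<gamma> = 0}"
  have G: "finite G" using finite_gen by (simp add: G_def)
  have inj: "inj_on fst G" by (auto simp: inj_on_def G_def prod_eq_iff)
  have rep: "\<exists>c. (\<forall>g\<in>fst ` G. 0 \<le> c g) \<and> y = (\<Sum>g\<in>fst ` G. c g *\<^sub>R g)" if yC: "y \<in> C" for y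
  proof -
    obtain c where c: "\<forall>\<gamma>\<in>\<Gamma>. 0 \<le> c \<gamma>" "(y, 0) = (\<Sum>\<gamma>\<in>\<Gamma>. c \<gamma> *\<^sub>R \<gamma>)"
      using C_gen[OF yC] by blast
    have "y = (\<Sum>\<gamma>\<in>G. c (fst \<gamma>, 0) *\<^sub>R fst \<gamma>)"
      unfolding level_zero_representation[OF c] G_def by (intro sum.cong refl) (auto simp: prod_eq_iff intro!: arg_cong[where f=c])
    also have "\<dots> = (\<Sum>g\<in>fst ` G. c (g, 0) *\<^sub>R g)" by (simp add: sum.reindex[OF inj])
    finally have "y = (\<Sum>g\<in>fst ` G. c (g, 0) *\<^sub>R g)" .
    moreover have "\<forall>g\<in>fst ` G. 0 \<le> c (g, 0)" using c(1) by (force simp: G_def)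
    ultimately show ?thesis by (intro exI[of _ "\<lambda>g. c (g, 0)"]) auto
  qed
  have fstC: "g \<in> C" if "g \<in> fst ` G" for g using that gen by (force simp: G_def)
  have "C \<subseteq> span (fst ` G)"
  proof
    fix y assume "y \<in> C"
    then obtain c where "y = (\<Sum>g\<in>fst ` G. c g *\<^sub>R g)" using rep by blast
    then show "y \<in> span (fst ` G)" by (simp add: span_sum span_scale span_base)
  qed
  then have span: "span (fst ` G) = UNIV" by (rule span_eq_UNIV_if_contains_C)
  have pointed: "(\<Sum>g\<in>fst ` G. c g *\<^sub>R g) \<noteq> - v" if "\<forall>g\<in>fst ` G. 0 \<le> c g" for c
    using cone_sum[of "fst ` G" "\<lambda>g. g" c] that fstC axis_pointed by metis
  obtain c0 where "\<forall>g\<in>fst ` G. 0 \<le> c0 g" "y = (\<Sum>g\<in>fst ` G. c0 g *\<^sub>R g)" using rep[OF assms] by blast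
  then obtain B c' where B: "v \<in> B" "B \<subseteq> insert v (fst ` G)" "independent B"
      "card B = DIM(real ^ 'n)" "\<forall>b\<in>B. 0 \<le> c' b" "y = (\<Sum>b\<in>B. c' b *\<^sub>R b)"
    using conic_basis_with_axis[OF finite_imageI[OF G] span pointed] by blast
  have finB: "finite B" using B(2) G finite_subset by blast
  obtain m where m: "m \<in> B" "\<And>b. b \<in> B \<Longrightarrow> c' m \<le> c' b"
    using ex_min_if_finite[of "c' ` B"] finB B(1) by (metis arg_min_if_finite(1) arg_min_least empty_iff)
  have "card B = CARD('n)" using B(4) by simp
  then obtain h :: "'n \<Rightarrow> _" where h: "bij_betw h UNIV B" "h k0 = m"
    using enumerate_with_first[OF finB _ m(1)] by blast
  have hB: "h k \<in> B" for k using h(1) by (auto simp: bij_betw_def)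
  have reindex: "(\<Sum>k\<in>UNIV. f (h k)) = (\<Sum>b\<in>B. f b)" for f :: "_ \<Rightarrow> 'c::comm_monoid_add"
    using sum.reindex_bij_betw[OF h(1)] by blast
  have injh: "inj h" using h(1) by (simp add: bij_betw_def)
  show ?thesis
  proof (rule that[of h "\<lambda>k. c' (h k)"])
    show "h k \<in> insert v (fst ` {\<gamma> \<in> \<Gamma>. snd \<gamma> = 0})" for k using hB B(2) by (auto simp: G_def)
    show "y = (\<Sum>k\<in>UNIV. c' (h k) *\<^sub>R h k)" using reindex[of "\<lambda>b. c' b *\<^sub>R b"] B(6) by simp
    fix z assume z: "(\<Sum>k\<in>UNIV. z k *\<^sub>R h k) = 0"
    have "(\<Sum>b\<in>B. z (inv h b) *\<^sub>R b) = 0"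
      using reindex[of "\<lambda>b. z (inv h b) *\<^sub>R b"] z injh by simp
    then have "\<forall>b\<in>B. z (inv h b) = 0"
      using independentD[OF B(3) finB order_refl, of "\<lambda>b. z (inv h b)"] by blast
    then show "\<forall>k. z k = 0" using hB injh by (metis inv_f_f)
  qed (use hB B(5) m h in auto)
qed

end

section \<open>Finitely many sweeps reach the whole polyhedron\<close>

text \<open>
  The data of a sweep that stays in \<open>K\<close> and for which the affine coordinates are
  available.
\<close>

definition admissible ::
  "'n::finite \<Rightarrow> (real ^ 'n) set \<Rightarrow> (real ^ 'n) set \<Rightarrow> ('n \<Rightarrow> real ^ 'n) \<Rightarrow> ('n \<Rightarrow> real ^ 'n) \<Rightarrow> real ^ 'n \<Rightarrow> 'n set \<Rightarrow> bool"
  where "admissible k0 K C P E V J \<longleftrightarrow> (\<forall>k. P k \<in> K) \<and> (\<forall>k. E k \<in> C) \<and> V \<in> C \<and> J \<subseteq> -{k0} \<and>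
    (\<forall>k\<in>J. P k = P k0) \<and> (\<forall>k. k \<notin> J \<longrightarrow> E k = 0) \<and> inj (frame k0 P E V)"

text \<open>
  The point \<open>q\<close> has coordinates with the margins that survive a small perturbation of
  the sweep.
\<close>

definition reaches ::
  "'n::finite \<Rightarrow> real \<Rightarrow> real \<Rightarrow> real \<Rightarrow> real \<Rightarrow> ('n \<Rightarrow> real ^ 'n) \<Rightarrow> ('n \<Rightarrow> real ^ 'n) \<Rightarrow> real ^ 'n \<Rightarrow> 'n set \<Rightarrow> real ^ 'n \<Rightarrow> bool"
  where "reaches k0 \<kappa> \<delta> A R P E V J q \<longleftrightarrow> (\<exists>z. q = P k0 + frame k0 P E V z \<and>
    0 \<le> z $ k0 \<and> (\<forall>k. k \<noteq> k0 \<longrightarrow> \<kappa> * z $ k0 \<le> z $ k) \<and>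
    2 * \<delta> \<le> 1 - (\<Sum>k\<in>-{k0}-J. z $ k) \<and> z $ k0 \<le> A * (1 + (\<Sum>k\<in>J. z $ k)) \<and>
    (J = -{k0} \<or> z $ k0 \<le> R))"

lemma inj_frameI:
  assumes "\<And>z. frame k0 P E V z = 0 \<Longrightarrow> z = 0"
  shows "inj (frame k0 P E V)"
  using assms linear_injective_0[OF linear_frame[of k0 P E V]] by blast

context generated_polyhedron
begin

text \<open>
  Points of \<open>p0 + C\<close> are reached by moving a cone with apex \<open>p0\<close> along
  one of its generators. If the generator with the smallest coefficient is taken as the axis, the
  other coefficients are at least as large as the height, so the margins come for free, and the
  height is at most the sum of the other coefficients, provided that there are any; hence the
  bound on the dimension.
\<close>

lemma deep_datum:
  fixes k0 :: 'n
  assumes n: "CARD('n) \<ge> 2" and y: "y \<in> C" and par: "0 < \<kappa>" "\<kappa> \<le> 1" "2 * \<delta> \<le> 1" "1 \<le> A"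
  obtains h where "\<And>k. h k \<in> insert v (fst ` {\<gamma> \<in> \<Gamma>. snd \<gamma> = 0})"
    "admissible k0 K C (\<lambda>_. p0) (\<lambda>k. if k = k0 then 0 else h k) (h k0) (-{k0})"
    "reaches k0 \<kappa> \<delta> A R (\<lambda>_. p0) (\<lambda>k. if k = k0 then 0 else h k) (h k0) (-{k0}) (p0 + y)"
proof -
  obtain h c where h: "\<And>k. h k \<in> insert v (fst ` {\<gamma> \<in> \<Gamma>. snd \<gamma> = 0})" and c: "\<And>k. 0 \<le> c k"
    and least: "\<And>k. c k0 \<le> c k" and y_eq: "y = (\<Sum>k\<in>UNIV. c k *\<^sub>R h k)"
    and indep: "\<And>z. (\<Sum>k\<in>UNIV. z k *\<^sub>R h k) = 0 \<Longrightarrow> (\<forall>k::'n. z k = 0)"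
    using cone_representation[OF y] by blast
  let ?E = "\<lambda>k. if k = k0 then 0 else h k"
  have hC: "h k \<in> C" for k using h[of k] gen axis_in_C by fastforce
  have frame: "frame k0 (\<lambda>_. p0) ?E (h k0) z = (\<Sum>k\<in>UNIV. z $ k *\<^sub>R h k)" for z
    unfolding frame_def sum_split_first[of _ k0] by (simp add: add.commute)
  have adm: "admissible k0 K C (\<lambda>_. p0) ?E (h k0) (-{k0})"
    unfolding admissible_def
  proof (intro conjI allI inj_frameI)
    fix z assume "frame k0 (\<lambda>_. p0) ?E (h k0) z = 0"
    then have "\<forall>k. z $ k = 0" unfolding frame by (rule indep)
    then show "z = 0" by (simp add: vec_eq_iff)
  qed (use p0 hC zero_in_C in auto)
  have "reaches k0 \<kappa> \<delta> A R (\<lambda>_. p0) ?E (h k0) (-{k0}) (p0 + y)"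
    unfolding reaches_def
  proof (intro exI[of _ "\<chi> k. c k"] conjI allI impI)
    show "p0 + y = p0 + frame k0 (\<lambda>_. p0) ?E (h k0) (\<chi> k. c k)" by (simp add: frame y_eq)
    fix k assume "k \<noteq> k0"
    have "\<kappa> * c k0 \<le> c k0" using mult_right_mono[OF par(2) c[of k0]] by simp
    then show "\<kappa> * (\<chi> k. c k) $ k0 \<le> (\<chi> k. c k) $ k" using least[of k] by simp
  next
    have "UNIV \<noteq> {k0}"
    proof
      assume "UNIV = {k0}"
      then have "CARD('n) = card {k0}" by (rule arg_cong)
      then show False using n by simp
    qed
    then obtain k where k: "k \<noteq> k0" by blast
    have "c k0 \<le> c k" by (rule least)
    also have "c k \<le> (\<Sum>k\<in>-{k0}. c k)" using k c by (intro member_le_sum) auto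
    finally have "c k0 \<le> 1 + (\<Sum>k\<in>-{k0}. c k)" by simp
    also have "\<dots> \<le> A * (1 + (\<Sum>k\<in>-{k0}. c k))"
      using mult_right_mono[OF par(4), of "1 + (\<Sum>k\<in>-{k0}. c k)"] sum_nonneg[of "-{k0}" c] c by simp
    finally show "(\<chi> k. c k) $ k0 \<le> A * (1 + (\<Sum>k\<in>-{k0}. (\<chi> k. c k) $ k))" by simp
  qed (use c par in auto)
  then show ?thesis using that h adm by blast
qed

text \<open>
  Above a piece from \<open>axis_representation\<close> the coefficients \<open>c k\<close> may be
  0, which leaves no margin. The remedy is to tilt the axis: replacing \<open>v\<close> by
  \<open>v\<close> minus \<open>\<epsilon>\<close> times the sum of the frame vectors raises each
  coefficient by \<open>\<epsilon> \<tau>\<close> at height \<open>\<tau>\<close>. The barycentric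
  coordinate of the vertex \<open>k0\<close> pays for this; it starts at \<open>1 / N\<close> or
  more, and keeps half of that as long as \<open>\<tau> \<le> R\<close>. A small
  \<open>\<epsilon>\<close> keeps the tilted axis in \<open>C\<close>.
\<close>

lemma near_datum:
  fixes k0 :: 'n
  defines "N \<equiv> real CARD('n)" and "b \<equiv> (\<Sum>\<gamma>\<in>\<Gamma>. norm (fst \<gamma>))"
  assumes \<epsilon>: "0 < \<epsilon>" "\<epsilon> * (N * (2 * b)) \<le> \<rho>" "N * (\<epsilon> * R) \<le> 1 / (2 * N)"
    and par: "\<kappa> \<le> \<epsilon>" "0 < R" "R \<le> A" "2 * \<delta> \<le> 1 / (2 * N)"
    and h: "\<And>k. h k \<in> \<Gamma>" "snd (h k0) = 1" and c: "\<And>k. 0 \<le> c k" "1 / N \<le> c k0"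
    and total: "(\<Sum>k\<in>UNIV. c k * snd (h k)) = 1" and \<tau>: "0 \<le> \<tau>" "\<tau> \<le> R"
    and indep: "\<And>z t. (\<Sum>k\<in>UNIV. z k *\<^sub>R h k) + t *\<^sub>R (v, 0) = 0 \<Longrightarrow> (\<forall>k::'n. z k = 0) \<and> t = 0"
  defines "P \<equiv> \<lambda>k. if snd (h k) = 1 then fst (h k) else fst (h k0)"
    and "E \<equiv> \<lambda>k. if snd (h k) = 1 then 0 else fst (h k)"
    and "J \<equiv> {k. k \<noteq> k0 \<and> snd (h k) = 0}"
  defines "V \<equiv> v - \<epsilon> *\<^sub>R (\<Sum>k\<in>-{k0}. E k + (P k - P k0))"
  shows "admissible k0 K C P E V J"
    and "reaches k0 \<kappa> \<delta> A R P E V J ((\<Sum>k\<in>UNIV. c k *\<^sub>R fst (h k)) + \<tau> *\<^sub>R v)"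
proof -
  have N: "N \<ge> 1" unfolding N_def using zero_less_card_finite[where 'a='n] by linarith
  define g where "g k = fst (h k) - snd (h k) *\<^sub>R fst (h k0)" for k
  have snd_h: "snd (h k) = 0 \<or> snd (h k) = 1" for k using gen[OF h(1)[of k]] by auto
  have g: "E k + (P k - P k0) = g k" for k
    using snd_h[of k] h(2) by (auto simp: E_def P_def g_def)
  have V: "V = v - \<epsilon> *\<^sub>R (\<Sum>k\<in>-{k0}. g k)" by (simp add: V_def g)
  have hb: "norm (fst (h k)) \<le> b" for k
    unfolding b_def by (rule member_le_sum[OF h(1), where f="\<lambda>\<gamma>. norm (fst \<gamma>)"]) (use finite_gen in auto)
  have b0: "0 \<le> b" unfolding b_def by (simp add: sum_nonneg)
  have gb: "norm (g k) \<le> 2 * b" for k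
  proof -
    have "norm (snd (h k) *\<^sub>R fst (h k0)) \<le> b" using snd_h[of k] hb[of k0] b0 by auto
    then show ?thesis using norm_triangle_ineq4[of "fst (h k)" "snd (h k) *\<^sub>R fst (h k0)"] hb[of k]
      by (simp add: g_def)
  qed
  have card: "real (card M) \<le> N" for M :: "'n set" unfolding N_def by (simp add: card_mono)
  have "V \<in> C"
  proof -
    have "norm (\<Sum>k\<in>-{k0}. g k) \<le> real (card (-{k0})) * (2 * b)"
      using gb by (intro sum_norm_bound) auto
    also have "\<dots> \<le> N * (2 * b)" using card[of "-{k0}"] b0 by (intro mult_right_mono) auto
    finally have "norm (- (\<epsilon> *\<^sub>R (\<Sum>k\<in>-{k0}. g k))) \<le> \<epsilon> * (N * (2 * b))"
      using \<epsilon>(1) by (simp add: mult_left_mono)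
    then show ?thesis using near_axis[of "- (\<epsilon> *\<^sub>R (\<Sum>k\<in>-{k0}. g k))"] \<epsilon>(2) V by simp
  qed
  moreover have "P k \<in> K" "E k \<in> C" for k
    using gen[OF h(1)[of k]] gen[OF h(1)[of k0]] h(2) zero_in_C by (auto simp: P_def E_def)
  moreover have "inj (frame k0 P E V)"
  proof (rule inj_frameI)
    fix z :: "real ^ 'n" assume z: "frame k0 P E V z = 0"
    define y where "y k = z $ k - \<epsilon> * z $ k0" for k
    (* The frame vectors are differences with \<open>h k0\<close>; collecting these terms gives a relation between the generators and the axis. *)
    define d where "d k = (if k = k0 then - (\<Sum>k\<in>-{k0}. y k * snd (h k)) else y k)" for k
    have "frame k0 P E V z = (\<Sum>k\<in>-{k0}. y k *\<^sub>R g k) + z $ k0 *\<^sub>R v"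
      unfolding frame_def g V
      by (simp add: y_def scaleR_diff_left scaleR_diff_right sum_subtractf scaleR_sum_right mult.commute)
    then have 0: "(\<Sum>k\<in>-{k0}. y k *\<^sub>R g k) + z $ k0 *\<^sub>R v = 0" using z by simp
    have d_sum: "(\<Sum>k\<in>-{k0}. d k *\<^sub>R h k) = (\<Sum>k\<in>-{k0}. y k *\<^sub>R h k)"
      by (intro sum.cong) (auto simp: d_def)
    have "(\<Sum>k\<in>UNIV. d k *\<^sub>R h k) + z $ k0 *\<^sub>R (v, 0) = 0"
      unfolding sum_split_first[of _ k0] d_sum
    proof (rule prod_eqI)
      show "fst (d k0 *\<^sub>R h k0 + (\<Sum>k\<in>-{k0}. y k *\<^sub>R h k) + z $ k0 *\<^sub>R (v, 0)) = fst 0"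
        using 0 by (simp add: d_def fst_sum g_def scaleR_diff_right sum_subtractf scaleR_sum_left)
      show "snd (d k0 *\<^sub>R h k0 + (\<Sum>k\<in>-{k0}. y k *\<^sub>R h k) + z $ k0 *\<^sub>R (v, 0)) = snd 0"
        using h(2) by (simp add: d_def snd_sum)
    qed
    then have "(\<forall>k. d k = 0) \<and> z $ k0 = 0" by (rule indep)
    then have "z $ k = 0" for k
      by (cases "k = k0") (auto simp: d_def y_def split: if_splits dest: spec[of _ k])
    then show "z = 0" by (simp add: vec_eq_iff)
  qed
  ultimately show "admissible k0 K C P E V J"
    using snd_h h(2) unfolding admissible_def by (auto simp: J_def P_def E_def)
  define z where "z = (\<chi> k. if k = k0 then \<tau> else c k + \<epsilon> * \<tau>)"
  have zk: "z $ k = c k + \<epsilon> * \<tau>" if "k \<noteq> k0" for k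
    using that by (simp add: z_def)
  have z0: "z $ k0 = \<tau>" by (simp add: z_def)
  have rest: "-{k0} - J = {k. k \<noteq> k0 \<and> snd (h k) = 1}" using snd_h by (auto simp: J_def)
  show "reaches k0 \<kappa> \<delta> A R P E V J ((\<Sum>k\<in>UNIV. c k *\<^sub>R fst (h k)) + \<tau> *\<^sub>R v)"
    unfolding reaches_def
  proof (intro exI[of _ z] conjI allI impI)
    have "(\<Sum>k\<in>-{k0}. z $ k *\<^sub>R g k) = (\<Sum>k\<in>-{k0}. c k *\<^sub>R g k) + (\<epsilon> * \<tau>) *\<^sub>R (\<Sum>k\<in>-{k0}. g k)"
      using zk by (simp add: scaleR_sum_right sum.distrib[symmetric] scaleR_add_left)
    then have "frame k0 P E V z = (\<Sum>k\<in>-{k0}. c k *\<^sub>R g k) + \<tau> *\<^sub>R v"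
      unfolding frame_def g V z0 by (simp add: scaleR_diff_right mult.commute)
    moreover have "(\<Sum>k\<in>-{k0}. c k *\<^sub>R g k) = (\<Sum>k\<in>UNIV. c k *\<^sub>R g k)"
      unfolding sum_split_first[of _ k0] using h(2) by (simp add: g_def)
    moreover have "(\<Sum>k\<in>UNIV. c k *\<^sub>R g k) = (\<Sum>k\<in>UNIV. c k *\<^sub>R fst (h k)) - fst (h k0)"
    proof -
      have "(\<Sum>k\<in>UNIV. c k *\<^sub>R g k)
          = (\<Sum>k\<in>UNIV. c k *\<^sub>R fst (h k)) - (\<Sum>k\<in>UNIV. c k * snd (h k)) *\<^sub>R fst (h k0)"
        by (simp add: g_def scaleR_diff_right sum_subtractf scaleR_sum_left)
      then show ?thesis by (simp add: total)
    qed
    ultimately show "(\<Sum>k\<in>UNIV. c k *\<^sub>R fst (h k)) + \<tau> *\<^sub>R v = P k0 + frame k0 P E V z"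
      using h(2) by (simp add: P_def)
    show "0 \<le> z $ k0" using \<tau> z0 by simp
    show "\<kappa> * z $ k0 \<le> z $ k" if "k \<noteq> k0" for k
      unfolding z0 zk[OF that] using c(1)[of k] mult_right_mono[OF par(1) \<tau>(1)] by linarith
    show "J = -{k0} \<or> z $ k0 \<le> R" using z0 \<tau> by simp
    have "z $ k \<ge> 0" for k using c \<tau> \<epsilon>(1) by (simp add: z_def)
    then have "1 \<le> 1 + (\<Sum>k\<in>J. z $ k)" by (simp add: sum_nonneg)
    then have "R * 1 \<le> A * (1 + (\<Sum>k\<in>J. z $ k))" using par by (intro mult_mono) auto
    then show "z $ k0 \<le> A * (1 + (\<Sum>k\<in>J. z $ k))" using z0 \<tau> by linarith
    have "(\<Sum>k\<in>-{k0}. c k * snd (h k)) = (\<Sum>k\<in>-{k0}-J. c k)"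
      unfolding rest by (rule sum.mono_neutral_cong_right) (use snd_h in auto)
    then have "c k0 = 1 - (\<Sum>k\<in>-{k0}-J. c k)"
      using total h(2) unfolding sum_split_first[of _ k0] by simp
    moreover have "(\<Sum>k\<in>-{k0}-J. z $ k) = (\<Sum>k\<in>-{k0}-J. c k) + real (card (-{k0}-J)) * (\<epsilon> * \<tau>)"
      using zk by (simp add: sum.distrib[symmetric] sum_constant[symmetric] del: sum_constant)
    moreover have "real (card (-{k0}-J)) * (\<epsilon> * \<tau>) \<le> N * (\<epsilon> * R)"
      using card[of "-{k0}-J"] \<epsilon>(1) \<tau> by (intro mult_mono) auto
    moreover have "1 / N = 1 / (2 * N) + 1 / (2 * N)" by simp
    ultimately show "2 * \<delta> \<le> 1 - (\<Sum>k\<in>-{k0}-J. z $ k)" using c(2) \<epsilon>(3) par(4) by linarith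
  qed
qed

text \<open>
  The bound \<open>R\<close> is chosen such that \<open>R *\<^sub>R v\<close> absorbs the
  difference between any point generator and \<open>p0\<close>. Points of height at most
  \<open>R\<close> are reached by tilted sweeps, and all others lie in \<open>p0 + C\<close>.
  There are finitely many data because each is determined by a choice of generators.
\<close>

lemma finite_sweep_cover:
  fixes k0 :: 'n
  assumes n: "CARD('n) \<ge> 2"
  obtains data \<kappa> \<delta> A R where "finite data" "0 < \<kappa>" "0 < \<delta>" "0 < A" "0 < R"
    "\<And>P E V J. (P, E, V, J) \<in> data \<Longrightarrow> admissible k0 K C P E V J"
    "\<And>q. q \<in> K \<Longrightarrow> \<exists>P E V J. (P, E, V, J) \<in> data \<and> reaches k0 \<kappa> \<delta> A R P E V J q"
proof -
  define N where "N = real CARD('n)"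
  have N: "N > 0" unfolding N_def by simp
  define b where "b = (\<Sum>\<gamma>\<in>\<Gamma>. norm (fst \<gamma>))"
  have b0: "0 \<le> b" unfolding b_def by (simp add: sum_nonneg)
  define R where "R = (b + norm p0 + 1) / \<rho>"
  have R: "R > 0" "R * \<rho> = b + norm p0 + 1"
    using \<rho> b0 by (simp_all add: R_def add_nonneg_pos)
  define \<epsilon> where "\<epsilon> = min (\<rho> / (N * (2 * b) + 1)) (1 / (2 * N * (N * R)))"
  have Nb: "N * (2 * b) \<ge> 0" using N b0 by simp
  have \<epsilon>0: "\<epsilon> > 0" unfolding \<epsilon>_def using \<rho> Nb N R by simp
  have \<epsilon>1: "\<epsilon> * (N * (2 * b)) \<le> \<rho>"
  proof -
    have "\<epsilon> * (N * (2 * b)) \<le> \<rho> / (N * (2 * b) + 1) * (N * (2 * b) + 1)"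
      using \<epsilon>0 Nb \<rho> by (intro mult_mono) (auto simp: \<epsilon>_def)
    then show ?thesis using Nb by simp
  qed
  have \<epsilon>2: "N * (\<epsilon> * R) \<le> 1 / (2 * N)"
  proof -
    have "\<epsilon> * (N * R) \<le> 1 / (2 * N * (N * R)) * (N * R)"
      using N R by (intro mult_right_mono) (auto simp: \<epsilon>_def)
    also have "\<dots> = 1 / (2 * N)" using N R by (simp add: field_simps)
    finally show ?thesis by (simp add: mult_ac)
  qed
  define \<kappa> where "\<kappa> = min \<epsilon> 1"
  define A where "A = max R 1"
  define \<delta> where "\<delta> = 1 / (4 * N)"
  have N1: "N \<ge> 2" using n by (simp add: N_def)
  have \<delta>: "2 * \<delta> \<le> 1 / (2 * N)" "2 * \<delta> \<le> 1" "\<delta> > 0" using N1 by (simp_all add: \<delta>_def field_simps)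
  define near where "near h =
     (let P = (\<lambda>k. if snd (h k) = 1 then fst (h k) else fst (h k0));
          E = (\<lambda>k. if snd (h k) = 1 then 0 else fst (h k))
      in (P, E, v - \<epsilon> *\<^sub>R (\<Sum>k\<in>-{k0}. E k + (P k - P k0)), {k. k \<noteq> k0 \<and> snd (h k) = 0}))" for h :: "'n \<Rightarrow> (real ^ 'n) \<times> real"
  define deep where "deep h = ((\<lambda>k::'n. p0), (\<lambda>k. if k = k0 then 0 else h k), h k0, -{k0})"
    for h :: "'n \<Rightarrow> real ^ 'n"
  define adm where "adm = (\<lambda>(P, E, V, J). admissible k0 K C P E V J)"
  define data where "data = {i \<in> near ` {h. \<forall>k. h k \<in> \<Gamma>} \<union>
      deep ` {h. \<forall>k. h k \<in> insert v (fst ` {\<gamma> \<in> \<Gamma>. snd \<gamma> = 0})}. adm i}"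
  have fin: "finite {h :: 'n \<Rightarrow> 'b. \<forall>k. h k \<in> S}" if "finite S" for S :: "'b set"
    using finite_set_of_finite_funs[OF finite[of "UNIV :: 'n set"] that, of undefined] by simp
  show ?thesis
  proof (rule that[of data \<kappa> \<delta> A R])
    show "finite data"
      unfolding data_def using finite_gen by (intro finite_subset[OF Collect_restrict] finite_UnI finite_imageI fin) auto
    show "admissible k0 K C P E V J" if "(P, E, V, J) \<in> data" for P E V J
      using that by (simp add: data_def adm_def)
    show "0 < \<kappa>" "0 < \<delta>" "0 < A" "0 < R" using \<epsilon>0 \<delta> R by (simp_all add: \<kappa>_def A_def)
    fix q assume q: "q \<in> K"
    obtain h c \<tau> where h: "\<And>k. h k \<in> \<Gamma>" "snd (h k0) = 1" and c: "\<And>k. 0 \<le> c k" and \<tau>: "0 \<le> \<tau>"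
      and ck0: "1 / real CARD('n) \<le> c k0" and total: "(\<Sum>k\<in>UNIV. c k * snd (h k)) = 1"
      and q_eq: "q = (\<Sum>k\<in>UNIV. c k *\<^sub>R fst (h k)) + \<tau> *\<^sub>R v"
      and indep: "\<And>z t. (\<Sum>k\<in>UNIV. z k *\<^sub>R h k) + t *\<^sub>R (v, 0) = 0 \<Longrightarrow> (\<forall>k::'n. z k = 0) \<and> t = 0"
      using axis_representation[OF q, of k0] by blast
    show "\<exists>P E V J. (P, E, V, J) \<in> data \<and> reaches k0 \<kappa> \<delta> A R P E V J q"
    proof (cases "\<tau> \<le> R")
      case True
      obtain P E V J where i: "near h = (P, E, V, J)" by (metis prod_cases4)
      have *: "admissible k0 K C P E V J \<and> reaches k0 \<kappa> \<delta> A R P E V J q"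
        using near_datum[OF \<epsilon>0 \<epsilon>1[unfolded N_def b_def] \<epsilon>2[unfolded N_def], of \<kappa> A \<delta> h k0 c \<tau>]
          R(1) \<delta>(1) h c ck0 total \<tau> True indep i
        unfolding near_def Let_def q_eq by (auto simp: \<kappa>_def A_def N_def)
      then have "adm (near h)" using i by (simp add: adm_def)
      then have "near h \<in> data" unfolding data_def using h(1) by blast
      then show ?thesis using i * by auto
    next
      case False
      have "c k *\<^sub>R (fst (h k) + snd (h k) *\<^sub>R (R *\<^sub>R v - p0)) \<in> C" for k
      proof (rule cone_scale[OF _ c])
        show "fst (h k) + snd (h k) *\<^sub>R (R *\<^sub>R v - p0) \<in> C"
        proof (cases "snd (h k) = 0")
          case True
          then show ?thesis using gen[OF h(1)[of k]] by simp
        next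
          case False
          then have s: "snd (h k) = 1" using gen[OF h(1)[of k]] by simp
          have "norm (fst (h k)) \<le> b"
            unfolding b_def by (rule member_le_sum[OF h(1), where f="\<lambda>\<gamma>. norm (fst \<gamma>)"]) (use finite_gen in auto)
          then have "norm (fst (h k) - p0) \<le> R * \<rho>"
            using norm_triangle_ineq4[of "fst (h k)" p0] R(2) by simp
          then have "R *\<^sub>R v + (fst (h k) - p0) \<in> C" using R(1) by (rule near_axis_scaled)
          then show ?thesis using s by (simp add: algebra_simps)
        qed
      qed
      then have "(\<Sum>k\<in>UNIV. 1 *\<^sub>R (c k *\<^sub>R (fst (h k) + snd (h k) *\<^sub>R (R *\<^sub>R v - p0)))) \<in> C"
        by (intro cone_sum) auto
      moreover have "(\<Sum>k\<in>UNIV. 1 *\<^sub>R (c k *\<^sub>R (fst (h k) + snd (h k) *\<^sub>R (R *\<^sub>R v - p0))))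
          = (\<Sum>k\<in>UNIV. c k *\<^sub>R fst (h k)) + (\<Sum>k\<in>UNIV. c k * snd (h k)) *\<^sub>R (R *\<^sub>R v - p0)"
        by (simp add: scaleR_add_right sum.distrib scaleR_sum_left)
      ultimately have "(\<Sum>k\<in>UNIV. c k *\<^sub>R fst (h k)) + (R *\<^sub>R v - p0) \<in> C"
        by (simp only: total scaleR_one)
      then have "((\<Sum>k\<in>UNIV. c k *\<^sub>R fst (h k)) + (R *\<^sub>R v - p0)) + (\<tau> - R) *\<^sub>R v \<in> C"
        by (rule cone_add) (use False axis_in_C in \<open>simp add: cone_scale\<close>)
      then have y: "q - p0 \<in> C" by (simp add: q_eq algebra_simps)
      obtain g where g: "\<And>k. g k \<in> insert v (fst ` {\<gamma> \<in> \<Gamma>. snd \<gamma> = 0})"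
        "admissible k0 K C (\<lambda>_. p0) (\<lambda>k. if k = k0 then 0 else g k) (g k0) (-{k0})"
        "reaches k0 \<kappa> \<delta> A R (\<lambda>_. p0) (\<lambda>k. if k = k0 then 0 else g k) (g k0) (-{k0}) (p0 + (q - p0))"
        using deep_datum[OF n y, of \<kappa> \<delta> A k0 R] \<epsilon>0 \<delta> by (auto simp: \<kappa>_def A_def)
      then have "deep g \<in> data"
        unfolding data_def by (auto simp: adm_def deep_def)
      then show ?thesis using g(3) unfolding deep_def by auto
    qed
  qed
qed

end

section \<open>The polyhedron and its interior as polynomial images\<close>

lemma sweep_reaches:
  fixes k0 :: "'n::finite"
  assumes adm: "admissible k0 K C P E V J" and pos: "0 < \<kappa>" "0 < \<delta>" "0 < A" "0 < R"
  shows "\<exists>\<epsilon>>0. \<forall>\<Phi>.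
    continuous_on ({0..3*A} \<times> {x. \<forall>k. 0 \<le> x $ k}) (\<lambda>(\<theta>, x). \<Phi> \<theta> x) \<longrightarrow>
    (\<forall>\<theta>\<in>{0..3*A}. \<forall>x. (\<forall>k. 0 \<le> x $ k) \<longrightarrow>
        norm (\<Phi> \<theta> x - sweep k0 P E V \<theta> x) \<le> \<epsilon> * (\<theta> * weight k0 x)) \<longrightarrow>
    (\<forall>q. reaches k0 \<kappa> \<delta> A R P E V J q \<longrightarrow> (\<exists>\<theta>\<in>{0..3*A}. \<exists>x. (\<forall>k. 0 \<le> x $ k) \<and> \<Phi> \<theta> x = q))"
proof -
  have J: "J \<subseteq> -{k0}" "\<And>k. k \<in> J \<Longrightarrow> P k = P k0" "\<And>k. k \<notin> J \<Longrightarrow> E k = 0"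
    and inj: "inj (frame k0 P E V)" using adm by (auto simp: admissible_def)
  show ?thesis
    using perturbed_sweep_covers[OF J inj pos] unfolding reaches_def by blast
qed

context generated_polyhedron
begin

text \<open>
  The finitely many sweeps tolerate a common relative error \<open>\<epsilon>\<close>; a
  polynomial map that imitates all of them with this precision is onto.
\<close>

lemma polynomial_image_if_dim_ge_2:
  assumes n: "CARD('n) \<ge> 2"
  shows "\<exists>f :: real ^ 'n \<Rightarrow> real ^ 'n. polynomial_function f \<and> range f = K"
proof -
  fix k0 :: 'n
  obtain data \<kappa> \<delta> A R where fin: "finite data" and pos: "0 < \<kappa>" "0 < \<delta>" "0 < A" "0 < R"
    and adm: "\<And>P E V J. (P, E, V, J) \<in> data \<Longrightarrow> admissible k0 K C P E V J"
    and cover: "\<And>q. q \<in> K \<Longrightarrow> \<exists>P E V J. (P, E, V, J) \<in> data \<and> reaches k0 \<kappa> \<delta> A R P E V J q"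
    by (rule finite_sweep_cover[OF n, of k0]) (rule that)
  obtain e where e: "bij_betw e {0..<card data} data"
    using ex_bij_betw_nat_finite[OF fin] by blast
  define N where "N = card data"
  define P where "P i = fst (e i)" for i
  define E where "E i = fst (snd (e i))" for i
  define V where "V i = fst (snd (snd (e i)))" for i
  define J where "J i = snd (snd (snd (e i)))" for i
  have "e i \<in> data" if "i < N" for i using e that by (auto simp: bij_betw_def N_def)
  then have admi: "admissible k0 K C (P i) (E i) (V i) (J i)" if "i < N" for i
    using that by (intro adm) (simp add: P_def E_def V_def J_def)
  have index: "\<exists>i<N. reaches k0 \<kappa> \<delta> A R (P i) (E i) (V i) (J i) q" if q: "q \<in> K" for q
  proof -
    obtain P' E' V' J' where i: "(P', E', V', J') \<in> data" "reaches k0 \<kappa> \<delta> A R P' E' V' J' q"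
      using cover[OF q] by blast
    have "data = e ` {0..<N}" using e by (simp add: bij_betw_def N_def)
    then obtain i where "i < N" "e i = (P', E', V', J')" using i(1) by auto
    then show ?thesis using i(2) by (intro exI[of _ i] conjI) (simp_all add: P_def E_def V_def J_def)
  qed
  define covers where "covers i \<epsilon> \<longleftrightarrow> (\<forall>\<Phi>.
    continuous_on ({0..3*A} \<times> {x. \<forall>k. 0 \<le> x $ k}) (\<lambda>(\<theta>, x). \<Phi> \<theta> x) \<longrightarrow>
    (\<forall>\<theta>\<in>{0..3*A}. \<forall>x. (\<forall>k. 0 \<le> x $ k) \<longrightarrow>
        norm (\<Phi> \<theta> x - sweep k0 (P i) (E i) (V i) \<theta> x) \<le> \<epsilon> * (\<theta> * weight k0 x)) \<longrightarrow>
    (\<forall>q. reaches k0 \<kappa> \<delta> A R (P i) (E i) (V i) (J i) q \<longrightarrow>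
      (\<exists>\<theta>\<in>{0..3*A}. \<exists>x. (\<forall>k. 0 \<le> x $ k) \<and> \<Phi> \<theta> x = q)))" for i \<epsilon>
  have "\<exists>\<epsilon>>0. covers i \<epsilon>" if "i < N" for i
    unfolding covers_def by (rule sweep_reaches[OF admi[OF that] pos])
  then obtain \<epsilon>' where \<epsilon>'0: "\<And>i. i < N \<Longrightarrow> 0 < \<epsilon>' i" and \<epsilon>': "\<And>i. i < N \<Longrightarrow> covers i (\<epsilon>' i)"
    by metis
  define \<epsilon> where "\<epsilon> = Min (insert 1 (\<epsilon>' ` {..<N}))"
  have \<epsilon>: "\<epsilon> > 0" "\<And>i. i < N \<Longrightarrow> \<epsilon> \<le> \<epsilon>' i"
    using \<epsilon>'0 by (simp_all add: \<epsilon>_def)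
  define r where "r = ((\<Sum>i<N. \<Sum>k\<in>UNIV. norm (P i k)) + norm p0 + 1) / \<rho>"
  have sum0: "0 \<le> (\<Sum>i<N. \<Sum>k\<in>UNIV. norm (P i k))" by (intro sum_nonneg) auto
  have r: "0 < r" "r * \<rho> = (\<Sum>i<N. \<Sum>k\<in>UNIV. norm (P i k)) + norm p0 + 1"
    using \<rho> sum0 by (simp_all add: r_def add_nonneg_pos)
  have Pu: "P i k + r *\<^sub>R v \<in> C" if "i < N" for i k
  proof -
    have "norm (P i k) \<le> (\<Sum>k\<in>UNIV. norm (P i k))" by (intro member_le_sum) auto
    also have "\<dots> \<le> (\<Sum>i<N. \<Sum>k\<in>UNIV. norm (P i k))"
      using that by (intro member_le_sum) (auto intro!: sum_nonneg)
    finally have "norm (P i k) \<le> r * \<rho>" using r(2) norm_ge_zero[of p0] by linarith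
    from near_axis_scaled[OF this r(1)] show ?thesis by (simp add: add.commute)
  qed
  have "norm p0 \<le> r * \<rho>" using r(2) sum0 by simp
  from near_axis_scaled[OF this r(1)] have pu: "p0 + r *\<^sub>R v \<in> C" by (simp add: add.commute)
  have uC: "r *\<^sub>R v \<in> C" using r(1) axis_in_C by (simp add: cone_scale)
  have mem: "P i k \<in> K" "E i k \<in> C" "V i \<in> C" if "i < N" for i k
    using admi[OF that] by (simp_all add: admissible_def)
  obtain f :: "real ^ 'n \<Rightarrow> real ^ 'n" and \<Phi>
  where f: "polynomial_function f" "range f \<subseteq> K"
    and cont: "\<And>i. i < N \<Longrightarrow> continuous_on ({0..3*A} \<times> {x. \<forall>k. 0 \<le> x $ k}) (\<lambda>(\<theta>, x). \<Phi> i \<theta> x)"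
    and ran: "\<And>i \<theta> x. \<lbrakk>i < N; \<theta> \<in> {0..3*A}; \<And>k. 0 \<le> x $ k\<rbrakk> \<Longrightarrow> \<Phi> i \<theta> x \<in> range f"
    and near: "\<And>i \<theta> x. \<lbrakk>i < N; \<theta> \<in> {0..3*A}; \<And>k. 0 \<le> x $ k\<rbrakk> \<Longrightarrow>
       norm (\<Phi> i \<theta> x - sweep k0 (P i) (E i) (V i) \<theta> x) \<le> \<epsilon> * (\<theta> * weight k0 x)"
    by (rule polynomial_map_near_sweeps[where N=N and P=P and E=E and V=V and ?k0.0=k0 and \<Theta>="3*A"
          and \<epsilon>=\<epsilon> and p=p0 and u="r *\<^sub>R v" and K=K and C=C])
      (use convex_with_recession_axioms mem p0 uC pu Pu \<epsilon>(1) pos(3) in \<open>auto\<close>)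
  have "q \<in> range f" if q: "q \<in> K" for q
  proof -
    obtain i where i: "i < N" "reaches k0 \<kappa> \<delta> A R (P i) (E i) (V i) (J i) q" using index[OF q] by blast
    have "\<forall>\<theta>\<in>{0..3*A}. \<forall>x. (\<forall>k. 0 \<le> x $ k) \<longrightarrow>
        norm (\<Phi> i \<theta> x - sweep k0 (P i) (E i) (V i) \<theta> x) \<le> \<epsilon>' i * (\<theta> * weight k0 x)"
    proof (intro ballI allI impI)
      fix \<theta> and x :: "real ^ 'n" assume \<theta>: "\<theta> \<in> {0..3*A}" and x: "\<forall>k. 0 \<le> x $ k"
      have "0 \<le> \<theta> * weight k0 x" using \<theta> x weight_ge_1[of k0 x] by simp
      then have "\<epsilon> * (\<theta> * weight k0 x) \<le> \<epsilon>' i * (\<theta> * weight k0 x)"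
        using \<epsilon>(2)[OF i(1)] by (intro mult_right_mono)
      then show "norm (\<Phi> i \<theta> x - sweep k0 (P i) (E i) (V i) \<theta> x) \<le> \<epsilon>' i * (\<theta> * weight k0 x)"
        by (rule order_trans[OF near[OF i(1) \<theta> spec[OF x]]])
    qed
    then obtain \<theta> x where "\<theta> \<in> {0..3*A}" "\<forall>k. 0 \<le> x $ k" "\<Phi> i \<theta> x = q"
      using \<epsilon>'[OF i(1), unfolded covers_def, rule_format, OF cont[OF i(1)] _ i(2)] by blast
    then show ?thesis using ran[OF i(1), of \<theta> x] by auto
  qed
  then show ?thesis using f by blast
qed

text \<open>
  In dimension 1 a piece is a single point, so sweeps reach bounded heights only; but here
  \<open>K\<close> is a half-line, an image of the squaring map.
\<close>

lemma polynomial_image_if_dim_1: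
  assumes n: "CARD('n) = 1"
  shows "\<exists>f :: real ^ 'n \<Rightarrow> real ^ 'n. polynomial_function f \<and> range f = K"
proof -
  obtain k0 :: 'n where k0: "UNIV = {k0}" using n by (auto simp: card_1_singleton_iff)
  have all_k0: "k = k0" for k :: 'n using k0 by blast
  have "v \<noteq> 0" using axis_pointed zero_in_C by auto
  then have vk: "v $ k0 \<noteq> 0" using all_k0 by (metis vec_eq_iff zero_index)
  define t where "t x = x $ k0 / v $ k0" for x :: "real ^ 'n"
  have x_eq: "x = t x *\<^sub>R v" for x
    unfolding vec_eq_iff
  proof
    fix k
    have "x $ k0 = (t x *\<^sub>R v) $ k0" using vk by (simp add: t_def)
    then show "x $ k = (t x *\<^sub>R v) $ k" by (simp only: all_k0[of k])
  qed
  define T where "T = t ` fst ` {\<gamma> \<in> \<Gamma>. snd \<gamma> = 1}"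
  have finT: "finite T" unfolding T_def using finite_gen by simp
  have rep: "\<exists>a\<in>T. \<exists>\<tau>\<ge>0. q = (a + \<tau>) *\<^sub>R v" if q: "q \<in> K" for q
  proof -
    obtain h c \<tau> where h: "\<And>k. h k \<in> \<Gamma>" "snd (h k0) = 1" and \<tau>: "0 \<le> \<tau>"
      and "(\<Sum>k\<in>UNIV. c k * snd (h k)) = 1" "q = (\<Sum>k\<in>UNIV. c k *\<^sub>R fst (h k)) + \<tau> *\<^sub>R v"
      using axis_representation[OF q, of k0] by blast
    then have "q = fst (h k0) + \<tau> *\<^sub>R v" by (simp add: k0)
    also have "\<dots> = (t (fst (h k0)) + \<tau>) *\<^sub>R v" using x_eq[of "fst (h k0)"] by (simp add: scaleR_add_left)
    finally have "q = (t (fst (h k0)) + \<tau>) *\<^sub>R v" .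
    moreover have "t (fst (h k0)) \<in> T" unfolding T_def using h by blast
    ultimately show ?thesis using \<tau> by blast
  qed
  define a where "a = Min T"
  have "T \<noteq> {}" using rep[OF p0] by auto
  then have a: "a \<in> T" "\<And>x. x \<in> T \<Longrightarrow> a \<le> x" using finT by (simp_all add: a_def)
  have "a *\<^sub>R v \<in> K"
  proof -
    obtain \<gamma> where "\<gamma> \<in> \<Gamma>" "snd \<gamma> = 1" "a = t (fst \<gamma>)" using a(1) by (auto simp: T_def)
    then show ?thesis using gen[of \<gamma>] x_eq[of "fst \<gamma>"] by simp
  qed
  define f where "f z = (a + (z $ k0)\<^sup>2) *\<^sub>R v" for z :: "real ^ 'n"
  have "real_polynomial_function (\<lambda>z :: real ^ 'n. a + (z $ k0)\<^sup>2)"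
    by (intro real_polynomial_function.intros(2-3) real_polynomial_function_power
        real_polynomial_function.intros(1) bounded_linear_vec_nth)
  then have "polynomial_function f"
    unfolding f_def by (intro polynomial_function_mult polynomial_function_const)
      (simp add: real_polynomial_function_eq)
  moreover have "range f = K"
  proof
    show "range f \<subseteq> K"
    proof
      fix y assume "y \<in> range f"
      then obtain z where "y = a *\<^sub>R v + (z $ k0)\<^sup>2 *\<^sub>R v" by (auto simp: f_def scaleR_add_left)
      then show "y \<in> K" using \<open>a *\<^sub>R v \<in> K\<close> axis_in_C by (simp add: add_K cone_scale)
    qed
    show "K \<subseteq> range f"
    proof
      fix q assume "q \<in> K"
      then obtain x \<tau> where x: "x \<in> T" "0 \<le> \<tau>" "q = (x + \<tau>) *\<^sub>R v" using rep by blast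
      then have "0 \<le> x + \<tau> - a" using a(2) by fastforce
      then have "f (\<chi> k. sqrt (x + \<tau> - a)) = q" using x(3) by (simp add: f_def)
      then show "q \<in> range f" by blast
    qed
  qed
  ultimately show ?thesis by blast
qed

end

text \<open>
  The polynomial map \<open>(x, y) \<mapsto> (y (x y - 1), (x y - 1)\<^sup>2 + x\<^sup>2)\<close>
  sends the plane onto the open upper half-plane. With \<open>m = x y - 1\<close> fixed and
  \<open>p \<noteq> 0\<close>, the first equation determines \<open>y\<close>, then
  \<open>x\<close>, and the second equation becomes one for \<open>m\<close> that the intermediate
  value theorem solves.
\<close>

lemma half_plane_surjection:
  fixes p r :: real
  assumes "0 < r"
  obtains x y where "y * (x * y - 1) = p" "(x * y - 1)\<^sup>2 + x\<^sup>2 = r"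
proof (cases "p = 0")
  case True
  show ?thesis
    by (rule that[where x="sqrt r" and y="1 / sqrt r"]) (use assms True in auto)
next
  case False
  define F where "F m = m\<^sup>2 + (m * (m + 1) / p)\<^sup>2" for m :: real
  define M where "M = r + 1"
  have "F 0 \<le> r" using assms by (simp add: F_def)
  moreover have "r \<le> F M"
  proof -
    have "M \<le> M\<^sup>2" using assms by (simp add: M_def power2_eq_square algebra_simps)
    also have "\<dots> \<le> F M" by (simp add: F_def)
    finally show ?thesis by (simp add: M_def)
  qed
  moreover have "continuous_on {0..M} F" unfolding F_def using False by (intro continuous_intros) auto
  ultimately obtain m where m: "0 \<le> m" "F m = r"
    using IVT'[of F 0 r M] assms by (auto simp: M_def)
  have "m \<noteq> 0" using m(2) assms by (auto simp: F_def)
  define x where "x = m * (m + 1) / p"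
  define y where "y = p / m"
  have xy: "x * y - 1 = m" using False \<open>m \<noteq> 0\<close> by (simp add: x_def y_def)
  show ?thesis
  proof (rule that)
    show "y * (x * y - 1) = p" unfolding xy using \<open>m \<noteq> 0\<close> by (simp add: y_def)
    show "(x * y - 1)\<^sup>2 + x\<^sup>2 = r" unfolding xy using m(2) by (simp add: F_def x_def)
  qed
qed

lemma polynomial_function_vec_lambda:
  fixes F :: "'n::finite \<Rightarrow> 'a::euclidean_space \<Rightarrow> real"
  assumes "\<And>k. real_polynomial_function (F k)"
  shows "polynomial_function (\<lambda>w. \<chi> k. F k w)"
  unfolding polynomial_function_iff_Basis_inner
proof
  fix b :: "real ^ 'n" assume "b \<in> Basis"
  then obtain k where "b = axis k 1" by (auto simp: Basis_vec_def)
  then show "real_polynomial_function (\<lambda>w. (\<chi> k. F k w) \<bullet> b)"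
    using assms[of k] by (simp add: inner_axis)
qed

text \<open>
  The interior of \<open>K\<close> is \<open>K\<close> plus the positive multiples of an interior
  vector \<open>v\<close> of the recession cone. The extra variable makes room for a pair of
  polynomials in place of \<open>z $ k0\<close>: one that takes the values of this coordinate, and
  one that independently takes all positive values.
\<close>

lemma interior_polynomial_image:
  fixes f :: "real ^ 'n::finite \<Rightarrow> real ^ 'n" and v :: "real ^ 'n"
  assumes f: "polynomial_function f" "range f = K"
    and add: "\<And>p x. \<lbrakk>p \<in> K; x \<in> C\<rbrakk> \<Longrightarrow> p + x \<in> K" and scale: "\<And>x r. \<lbrakk>x \<in> C; 0 \<le> r\<rbrakk> \<Longrightarrow> r *\<^sub>R x \<in> C"
    and \<rho>: "0 < \<rho>" "\<And>x. norm x \<le> \<rho> \<Longrightarrow> v + x \<in> C"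
  shows "\<exists>g :: real ^ ('n option) \<Rightarrow> real ^ 'n. polynomial_function g \<and> range g = interior K"
proof -
  fix k0 :: 'n
  define X where "X w = w $ Some k0" for w :: "real ^ ('n option)"
  define Y where "Y w = w $ None" for w :: "real ^ ('n option)"
  define z where "z w = (\<chi> k. if k = k0 then Y w * (X w * Y w - 1) else w $ Some k)" for w :: "real ^ ('n option)"
  define \<tau> where "\<tau> w = (X w * Y w - 1)\<^sup>2 + (X w)\<^sup>2" for w :: "real ^ ('n option)"
  define g where "g w = f (z w) + \<tau> w *\<^sub>R v" for w
  have coord: "real_polynomial_function (\<lambda>w :: real ^ ('n option). w $ i)" for i
    by (intro real_polynomial_function.intros(1) bounded_linear_vec_nth)
  note pf = real_polynomial_function.intros(2-4) real_polynomial_function_diff real_polynomial_function_power coord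
  have "real_polynomial_function (\<lambda>w. if k = k0 then Y w * (X w * Y w - 1) else w $ Some k)" for k
    unfolding X_def Y_def by (cases "k = k0") (simp_all add: pf)
  then have "polynomial_function z"
    unfolding z_def by (rule polynomial_function_vec_lambda)
  then have "polynomial_function (\<lambda>w. f (z w))"
    using polynomial_function_compose[OF _ f(1), of z] by (simp add: o_def)
  moreover have "real_polynomial_function \<tau>" unfolding \<tau>_def X_def Y_def by (intro pf)
  ultimately have "polynomial_function g"
    unfolding g_def by (intro polynomial_function_add polynomial_function_mult polynomial_function_const)
      (simp_all add: real_polynomial_function_eq)
  moreover have "range g = interior K"
  proof
    show "range g \<subseteq> interior K"
    proof
      fix y assume "y \<in> range g"
      then obtain w where y: "y = f (z w) + \<tau> w *\<^sub>R v" by (auto simp: g_def)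
      have \<tau>: "\<tau> w > 0"
      proof -
        have "\<not> (X w * Y w - 1 = 0 \<and> X w = 0)" by auto
        then show ?thesis unfolding \<tau>_def by (simp add: sum_power2_gt_zero_iff)
      qed
      have "ball y (\<tau> w * \<rho>) \<subseteq> K"
      proof
        fix x assume "x \<in> ball y (\<tau> w * \<rho>)"
        then have "norm (x - y) \<le> \<tau> w * \<rho>" by (simp add: dist_norm norm_minus_commute)
        then have "norm ((x - y) /\<^sub>R \<tau> w) \<le> \<rho>"
          using \<tau> by (simp add: inverse_eq_divide divide_le_eq mult.commute)
        then have "f (z w) + \<tau> w *\<^sub>R (v + (x - y) /\<^sub>R \<tau> w) \<in> K"
          using f(2) \<tau> \<rho>(2) by (intro add scale) auto
        moreover have "f (z w) + \<tau> w *\<^sub>R (v + (x - y) /\<^sub>R \<tau> w) = x"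
          using \<tau> by (simp add: y scaleR_add_right)
        ultimately show "x \<in> K" by simp
      qed
      then show "y \<in> interior K"
        unfolding mem_interior using \<tau> \<rho>(1) by (intro exI[of _ "\<tau> w * \<rho>"]) simp
    qed
    show "interior K \<subseteq> range g"
    proof
      fix q assume "q \<in> interior K"
      then obtain r where r: "r > 0" "cball q r \<subseteq> K" by (auto simp: mem_interior_cball)
      define s where "s = r / (norm v + 1)"
      have s: "s > 0" using r by (simp add: s_def add_nonneg_pos)
      have "norm (s *\<^sub>R v) \<le> r"
      proof -
        have "s * norm v \<le> s * (norm v + 1)" using s by simp
        also have "\<dots> = r" using norm_ge_zero[of v] by (simp add: s_def add_nonneg_eq_0_iff)
        finally show ?thesis using s by simp
      qed
      then have "q - s *\<^sub>R v \<in> cball q r" by (simp add: dist_norm)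
      then have "q - s *\<^sub>R v \<in> range f" using r(2) unfolding f(2) by blast
      then obtain z' where z': "f z' = q - s *\<^sub>R v" by (metis imageE)
      obtain x y where xy: "y * (x * y - 1) = z' $ k0" "(x * y - 1)\<^sup>2 + x\<^sup>2 = s"
        using half_plane_surjection[OF s] by metis
      define w where "w = (\<chi> i. case i of None \<Rightarrow> y | Some k \<Rightarrow> if k = k0 then x else z' $ k)"
      have "z w = z'" using xy(1) by (simp add: z_def X_def Y_def w_def vec_eq_iff)
      moreover have "\<tau> w = s" using xy(2) by (simp add: \<tau>_def X_def Y_def w_def)
      ultimately have "g w = q" using z' by (simp add: g_def)
      then show "q \<in> range g" by blast
    qed
  qed
  ultimately show ?thesis by blast
qed

theorem theorem1p1:
  fixes K :: "(real ^ 'n::finite) set"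
  assumes "polyhedron K"
    and "K \<noteq> {}"
    and "aff_dim K = int CARD('n)"
    and "aff_dim (recession_cone K) = int CARD('n)"
  shows "(\<exists>f :: real ^ 'n \<Rightarrow> real ^ 'n. polynomial_function f \<and> range f = K) \<and>
    (\<exists>g :: real ^ ('n option) \<Rightarrow> real ^ 'n. polynomial_function g \<and> range g = rel_interior K)"
proof -
  define C where "C = recession_cone K"
  have convK: "convex K" using assms(1) by (rule polyhedron_imp_convex)
  interpret convex_with_recession K C
    unfolding C_def by (rule convex_with_recession_cone[OF convK])
  have "interior C = rel_interior C"
    using assms(4) by (simp add: interior_rel_interior_gen C_def)
  moreover have "rel_interior C \<noteq> {}" using rel_interior_eq_empty[OF convex_C] zero_in_C by auto
  ultimately obtain v where "v \<in> interior C" by blast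
  then obtain \<rho> where \<rho>: "0 < \<rho>" "cball v \<rho> \<subseteq> C" by (auto simp: mem_interior_cball)
  have near: "v + x \<in> C" if "norm x \<le> \<rho>" for x
    using \<rho>(2) that by (auto simp: dist_norm)
  have image: "\<exists>f :: real ^ 'n \<Rightarrow> real ^ 'n. polynomial_function f \<and> range f = K"
  proof (cases "- v \<in> C")
    case True
    (* A cone that contains the negative of an interior vector is everything. *)
    have C: "x \<in> C" for x
    proof -
      define r where "r = norm x / \<rho> + 1"
      have r: "0 < r" "norm x \<le> r * \<rho>"
        using \<rho>(1) by (simp_all add: r_def add_nonneg_pos distrib_right)
      then have "norm (x /\<^sub>R r) \<le> \<rho>" by (simp add: inverse_eq_divide divide_le_eq mult.commute)
      then have "v + x /\<^sub>R r \<in> C" by (rule near)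
      then have "r *\<^sub>R (v + x /\<^sub>R r) + r *\<^sub>R (- v) \<in> C"
        using True r(1) by (intro cone_add[OF cone_scale cone_scale]) auto
      then show ?thesis using r by (simp add: scaleR_add_right)
    qed
    obtain p where p: "p \<in> K" using assms(2) by blast
    have "x \<in> K" for x using add_K[OF p C[of "x - p"]] by simp
    then have "range (\<lambda>x. x) = K" by auto
    then show ?thesis using polynomial_function_id by blast
  next
    case False
    obtain \<Gamma> :: "((real ^ 'n) \<times> real) set" where \<Gamma>: "finite \<Gamma>"
      "\<And>\<gamma>. \<gamma> \<in> \<Gamma> \<Longrightarrow> (snd \<gamma> = 1 \<and> fst \<gamma> \<in> K) \<or> (snd \<gamma> = 0 \<and> fst \<gamma> \<in> C)"
      "\<And>q. q \<in> K \<Longrightarrow> \<exists>c. (\<forall>\<gamma>\<in>\<Gamma>. 0 \<le> c \<gamma>) \<and> (q, 1) = (\<Sum>\<gamma>\<in>\<Gamma>. c \<gamma> *\<^sub>R \<gamma>)"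
      "\<And>y. y \<in> C \<Longrightarrow> \<exists>c. (\<forall>\<gamma>\<in>\<Gamma>. 0 \<le> c \<gamma>) \<and> (y, 0) = (\<Sum>\<gamma>\<in>\<Gamma>. c \<gamma> *\<^sub>R \<gamma>)"
      unfolding C_def by (rule homogeneous_generators[OF assms(1,2)]) blast
    obtain p0 where "p0 \<in> K" using assms(2) by blast
    then interpret generated_polyhedron K C v \<rho> \<Gamma> p0
      by unfold_locales (use \<rho>(1) near False \<Gamma> in auto)
    have "CARD('n) \<ge> 1" using zero_less_card_finite[where 'a='n] by linarith
    then consider "CARD('n) = 1" | "CARD('n) \<ge> 2" by linarith
    then show ?thesis
      using polynomial_image_if_dim_1 polynomial_image_if_dim_ge_2 by cases auto
  qed
  moreover have "rel_interior K = interior K"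
    using assms(3) by (simp add: interior_rel_interior_gen)
  ultimately show ?thesis
    using interior_polynomial_image[OF _ _ add_K cone_scale \<rho>(1) near] by metis
qed

end
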